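(* Let $X$ be a linearly repetitive or densely repetitive Delone set in $\mathbb{R}^n$. Then $X$ has a unique autocorrelation measure $\gamma_X$. This measure $\gamma_X$ is a pure discrete measure supported on $X-X$. In particular $X$ is diffractive.
   Context: A Delone set in $\mathbb{R}^n$ is a set $X\subset\mathbb{R}^n$ for which there are $r,R>0$ such that each open ball of radius $r$ contains at most one point of $X$ and each closed ball of radius $R$ contains at least one point of $X$. $B(\mathbf{x};T)$ is the closed ball of radius $T$ centered at $\mathbf{x}$. For $\mathbf{x}\in X$ the $T$-patch of $X$ at $\mathbf{x}$ is $X\cap B(\mathbf{x};T)$. $N_X(T)$ is the number of distinct sets $(X\cap B(\mathbf{x};T))-\mathbf{x}$, $\mathbf{x}\in X$. $X$ is repetitive if for each $T>0$ there is a finite $M>0$ such that every closed ball of radius $M$ in $\mathbb{R}^n$ contains, for every $\mathbf{y}\in X$, some $\mathbf{x}\in X$ with $(X\cap B(\mathbf{x};T))-\mathbf{x}=(X\cap B(\mathbf{y};T))-\mathbf{y}$; $M_X(T)$ denotes the least such $M$. A repetitive $X$ is linearly repetitive if $M_X(T)=O(T)$ as $T\to\infty$, and densely repetitive if $M_X(T)=O(N_X(T)^{1/n})$ as $T\to\infty$. An autocorrelation measure of a discrete set $X\subset\mathbb{R}^n$ is any limit (accumulation) measure in the vague topology, as $T\to\infty$, of the measures $$\mu_T:=\frac{1}{\kappa_nT^n}\sum_{\mathbf{x}_1,\mathbf{x}_2\in X,\ \|\mathbf{x}_1\|,\|\mathbf{x}_2\|<T}\delta_{\mathbf{x}_1-\mathbf{x}_2},\qquad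 T>0,$$ where $\kappa_n$ is the volume of the unit ball in $\mathbb{R}^n$ and $\delta_{\mathbf{z}}$ is the unit point mass at $\mathbf{z}$. Measures are regarded as linear functionals on the space of complex-valued continuous compactly supported functions on $\mathbb{R}^n$ (bounded, in sup norm, on functions supported in any fixed compact set), and $\mu_k\to\mu$ vaguely means $\mu_k(f)\to\mu(f)$ for every such $f$. $X$ is diffractive if it has a unique autocorrelation measure. *)

theory Defs
  imports "HOL-Analysis.Analysis" "HOL-Library.Landau_Symbols"
begin

section \<open>Delone sets and repetitivity\<close>

definition delone :: "(real ^ 'n) set \<Rightarrow> bool" where
  "delone X \<longleftrightarrow> (\<exists>r>0. \<exists>R>0.
     (\<forall>c. \<exists>\<^sub>\<le>\<^sub>1 x. x \<in> X \<inter> ball c r) \<and> (\<forall>c. X \<inter> cball c R \<noteq> {}))"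

definition centred_patch :: "(real ^ 'n) set \<Rightarrow> real \<Rightarrow> real ^ 'n \<Rightarrow> (real ^ 'n) set" where
  "centred_patch X T x = (\<lambda>z. z - x) ` (X \<inter> cball x T)"

text \<open>For a repetitive Delone set there are only finitely many patches of each radius
  (lemma \<open>finite_patches\<close> below), so that \<^const>\<open>card\<close> is the true number of them.\<close>

definition patch_count :: "(real ^ 'n) set \<Rightarrow> real \<Rightarrow> nat" where
  "patch_count X T = card (centred_patch X T ` X)"

definition recurrence_radius :: "(real ^ 'n) set \<Rightarrow> real \<Rightarrow> real \<Rightarrow> bool" where
  "recurrence_radius X T M \<longleftrightarrow> M > 0 \<and>
     (\<forall>c. \<forall>y\<in>X. \<exists>x \<in> X \<inter> cball c M. centred_patch X T x = centred_patch X T y)"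

definition repetitive :: "(real ^ 'n) set \<Rightarrow> bool" where
  "repetitive X \<longleftrightarrow> (\<forall>T>0. \<exists>M. recurrence_radius X T M)"

text \<open>The minimum is attained if \<open>X\<close> is a repetitive Delone set and \<open>T > 0\<close>;
  see lemma \<open>recurrence_radius_repetitivity\<close> below.\<close>

definition repetitivity :: "(real ^ 'n) set \<Rightarrow> real \<Rightarrow> real" where
  "repetitivity X T = (LEAST M. recurrence_radius X T M)"

definition linearly_repetitive :: "(real ^ 'n) set \<Rightarrow> bool" where
  "linearly_repetitive X \<longleftrightarrow> repetitive X \<and> repetitivity X \<in> O[at_top](\<lambda>T. T)"

definition densely_repetitive :: "(real ^ 'n) set \<Rightarrow> bool" where
  "densely_repetitive X \<longleftrightarrow> repetitive X \<and>
     repetitivity X \<in> O[at_top](\<lambda>T. real (patch_count X T) powr (1 / real CARD('n)))"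

lemma delone_finite_cball:
  fixes X :: "(real ^ 'n) set"
  assumes "delone X"
  shows "finite (X \<inter> cball c M)"
proof -
  obtain r where r: "r > 0" "\<And>c. \<exists>\<^sub>\<le>\<^sub>1 x. x \<in> X \<inter> ball c r"
    using assms unfolding delone_def by blast
  have "\<exists>C. finite C \<and> C \<subseteq> cball c M \<and> cball c M \<subseteq> (\<Union>a\<in>C. ball a r)"
    using seq_compact_imp_totally_bounded[of "cball c M"] r(1) compact_cball
    by (metis compact_imp_seq_compact)
  then obtain C where C: "finite C" "cball c M \<subseteq> (\<Union>a\<in>C. ball a r)" by blast
  have "finite (X \<inter> ball a r)" for a
  proof (cases "X \<inter> ball a r = {}")
    case False
    then obtain x where x: "x \<in> X \<inter> ball a r" by blast
    have "X \<inter> ball a r \<subseteq> {x}" using r(2)[of a] x unfolding Uniq_def by blast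
    then show ?thesis using finite_subset by blast
  qed auto
  then have "finite (\<Union>a\<in>C. X \<inter> ball a r)" using C(1) by blast
  then show ?thesis by (rule rev_finite_subset) (use C(2) in auto)
qed

lemma finite_patches:
  fixes X :: "(real ^ 'n) set"
  assumes "delone X" "repetitive X" "T > 0"
  shows "finite (centred_patch X T ` X)"
proof -
  obtain M where M: "recurrence_radius X T M"
    using assms unfolding repetitive_def by blast
  have "centred_patch X T ` X \<subseteq> centred_patch X T ` (X \<inter> cball 0 M)"
  proof
    fix P assume "P \<in> centred_patch X T ` X"
    then obtain y where "y \<in> X" "P = centred_patch X T y" by blast
    then show "P \<in> centred_patch X T ` (X \<inter> cball 0 M)"
      using M unfolding recurrence_radius_def by (metis imageI)
  qed
  then show ?thesis using delone_finite_cball[OF assms(1)] finite_subset by blast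
qed

lemma recurrence_radius_repetitivity:
  fixes X :: "(real ^ 'n) set"
  assumes X: "delone X" and rep: "repetitive X" and T: "T > 0"
  shows "recurrence_radius X T (repetitivity X T)"
    and "recurrence_radius X T M \<Longrightarrow> repetitivity X T \<le> M"
proof -
  let ?S = "{M. recurrence_radius X T M}"
  define m where "m = Inf ?S"
  have ne: "?S \<noteq> {}" using rep T unfolding repetitive_def by blast
  have bdd: "bdd_below ?S" by (rule bdd_belowI[of _ 0]) (auto simp: recurrence_radius_def)
  have "X \<noteq> {}" using X unfolding delone_def by blast
  have hit: "\<exists>x \<in> X \<inter> cball c m. centred_patch X T x = centred_patch X T y"
    if y: "y \<in> X" for c y
  proof (rule ccontr)
    assume no: "\<not> ?thesis"
    have far: "dist c x > m" if "x \<in> X" "centred_patch X T x = centred_patch X T y" for x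
    proof -
      have "x \<notin> cball c m" using no that by blast
      then show ?thesis by simp
    qed
    define F where "F = {x \<in> X \<inter> cball c (m + 1). centred_patch X T x = centred_patch X T y}"
    have "finite F" unfolding F_def using delone_finite_cball[OF X, of c "m + 1"]
      by (rule rev_finite_subset) blast
    define d where "d = Min (insert (m + 1) (dist c ` F))"
    have d: "m < d" "d \<le> m + 1" "\<And>x. x \<in> F \<Longrightarrow> d \<le> dist c x"
      using \<open>finite F\<close> far unfolding d_def by (auto simp: F_def)
    obtain M where M: "recurrence_radius X T M" "M < d"
      using d(1) cInf_less_iff[OF ne bdd] unfolding m_def by auto
    then obtain x where x: "x \<in> X \<inter> cball c M" "centred_patch X T x = centred_patch X T y"
      using y unfolding recurrence_radius_def by blast
    then have "x \<in> F" using M(2) d(2) by (auto simp: F_def)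
    then show False using d(3)[of x] x(1) M(2) by auto
  qed
  have "m > 0"
  proof (rule ccontr)
    assume "\<not> m > 0"
    obtain y where y: "y \<in> X" using \<open>X \<noteq> {}\<close> by blast
    have "c \<in> X" for c
    proof -
      obtain x where "x \<in> X" "dist c x \<le> m" using hit[OF y, of c] by auto
      moreover from this have "dist c x = 0"
        using \<open>\<not> m > 0\<close> zero_le_dist[of c x] by linarith
      ultimately show ?thesis by simp
    qed
    then have "X = UNIV" by auto
    then have "finite (cball (0 :: real ^ 'n) 1)"
      using delone_finite_cball[OF X, of 0 1] by simp
    then show False
      using uncountable_cball[of 1 "0 :: real ^ 'n"] uncountable_infinite by auto
  qed
  have m: "recurrence_radius X T m"
    unfolding recurrence_radius_def using \<open>m > 0\<close> hit by blast
  have least: "m \<le> M" if "recurrence_radius X T M" for M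
    using that bdd unfolding m_def by (simp add: cInf_lower)
  have eq: "repetitivity X T = m"
    unfolding repetitivity_def using m least by (rule Least_equality)
  show "recurrence_radius X T (repetitivity X T)" using m eq by simp
  show "recurrence_radius X T M \<Longrightarrow> repetitivity X T \<le> M" using least eq by simp
qed

section \<open>Measures as functionals, and the vague topology\<close>

definition test_functions :: "(real ^ 'n \<Rightarrow> complex) set" where
  "test_functions = {f. continuous_on UNIV f \<and> compact (closure {x. f x \<noteq> 0})}"

text \<open>A measure is a functional on \<^const>\<open>test_functions\<close>. In order that two measures be equal
  as soon as they agree there, their values elsewhere are fixed by \<^const>\<open>extensional\<close>.\<close>

definition functional_measure :: "((real ^ 'n \<Rightarrow> complex) \<Rightarrow> complex) \<Rightarrow> bool" where
  "functional_measure \<mu> \<longleftrightarrow>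
     \<mu> \<in> extensional test_functions \<and>
     (\<forall>f\<in>test_functions. \<forall>g\<in>test_functions. \<mu> (\<lambda>x. f x + g x) = \<mu> f + \<mu> g) \<and>
     (\<forall>a. \<forall>f\<in>test_functions. \<mu> (\<lambda>x. a * f x) = a * \<mu> f) \<and>
     (\<forall>K. compact K \<longrightarrow> (\<exists>C. \<forall>f\<in>test_functions. closure {x. f x \<noteq> 0} \<subseteq> K \<longrightarrow>
        norm (\<mu> f) \<le> C * (SUP x. norm (f x))))"

definition vague_limit ::
  "(nat \<Rightarrow> (real ^ 'n \<Rightarrow> complex) \<Rightarrow> complex) \<Rightarrow> ((real ^ 'n \<Rightarrow> complex) \<Rightarrow> complex) \<Rightarrow> bool" where
  "vague_limit \<mu>s \<mu> \<longleftrightarrow> (\<forall>f\<in>test_functions. (\<lambda>k. \<mu>s k f) \<longlonglongrightarrow> \<mu> f)"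

text \<open>\<open>\<mu> = (\<Sum>z\<in>A. c z \<delta>\<^sub>z)\<close>, where \<open>c\<close> is absolutely summable over the part of \<open>A\<close> in
  each compact set, so that all but countably many points of \<open>A\<close> have weight zero.\<close>

definition pure_discrete_on ::
  "(real ^ 'n) set \<Rightarrow> ((real ^ 'n \<Rightarrow> complex) \<Rightarrow> complex) \<Rightarrow> bool" where
  "pure_discrete_on A \<mu> \<longleftrightarrow> (\<exists>c :: real ^ 'n \<Rightarrow> complex.
     (\<forall>K. compact K \<longrightarrow> (\<lambda>z. norm (c z)) summable_on (A \<inter> K)) \<and>
     (\<forall>f\<in>test_functions. \<mu> f = (\<Sum>\<^sub>\<infinity>z\<in>A. c z * f z)))"

section \<open>Autocorrelation\<close>

definition autocorrelation_approx ::
  "(real ^ 'n) set \<Rightarrow> real \<Rightarrow> (real ^ 'n \<Rightarrow> complex) \<Rightarrow> complex" where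
  "autocorrelation_approx X T = (\<lambda>f\<in>test_functions.
     complex_of_real (1 / (measure lborel (cball (0 :: real ^ 'n) 1) * T ^ CARD('n))) *
     (\<Sum>(x, y) \<in> {x \<in> X. norm x < T} \<times> {y \<in> X. norm y < T}. f (x - y)))"

definition autocorrelation_measure ::
  "(real ^ 'n) set \<Rightarrow> ((real ^ 'n \<Rightarrow> complex) \<Rightarrow> complex) \<Rightarrow> bool" where
  "autocorrelation_measure X \<gamma> \<longleftrightarrow> functional_measure \<gamma> \<and>
     (\<exists>T :: nat \<Rightarrow> real. (\<forall>k. T k > 0) \<and> filterlim T at_top sequentially \<and>
        vague_limit (\<lambda>k. autocorrelation_approx X (T k)) \<gamma>)"

definition diffractive :: "(real ^ 'n) set \<Rightarrow> bool" where
  "diffractive X \<longleftrightarrow> (\<exists>!\<gamma>. autocorrelation_measure X \<gamma>)"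

end

theory Submission
  imports Defs
begin

text \<open>Fix a difference \<open>z\<close> and count the points \<open>x\<close> with \<open>x, x + z \<in> X\<close> in half-open cubes.  Since cubes
  tile larger cubes, the extreme densities of this count converge to a lower density \<open>l\<close> and an upper
  density \<open>u\<close>.  Suppose \<open>l < u\<close>, and let \<open>\<theta>\<close> lie between them.  A cube of nearly minimal density,
  with side comparable to the repetitivity radius \<open>M\<close>, is tiled by cubes of side \<open>t\<close> whose densities are
  at least about \<open>l\<close>; so by double counting only a small fraction of its tiles lie next to a cube of
  side \<open>m t\<close> and density at least \<open>\<theta>\<close>.  Dually, a cube of nearly maximal density contains few places of
  density at most \<open>\<theta>\<close>.  But every patch of radius about \<open>m t\<close> is of one of these two kinds, and occurs
  in both large cubes.  If \<open>M\<close> is of order \<open>t\<close> this is absurd as soon as the fraction is below the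
  reciprocal of the number of tiles; otherwise it bounds the number of patches by an arbitrarily small
  multiple of \<open>M\<^sup>n\<close>, which contradicts dense repetitivity.  So \<open>l = u\<close>, and the frequency of \<open>z\<close> exists
  in balls as well.  As \<open>X - X\<close> is locally finite, the autocorrelation evaluated at a test function is
  a finite sum of such frequencies.\<close>

section \<open>Half-open cubes and grids\<close>

text \<open>Half-open, so that the cubes of a lattice partition space and counts over them add up
  exactly.\<close>

definition hcube :: "real ^ 'n \<Rightarrow> real \<Rightarrow> (real ^ 'n) set" where
  "hcube p s = {y. \<forall>i. p $ i \<le> y $ i \<and> y $ i < p $ i + s}"

text \<open>The label of the cell containing \<open>y\<close> in the tiling of side \<open>t\<close>
  with origin \<open>p\<close>. Labels turn cells into integer vectors, so that moving by whole
  cells is addition.\<close>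

definition cell_index :: "real ^ 'n \<Rightarrow> real \<Rightarrow> real ^ 'n \<Rightarrow> int ^ 'n" where
  "cell_index p t y = (\<chi> i. \<lfloor>(y $ i - p $ i) / t\<rfloor>)"

text \<open>Both bounds are free because covers from outside use offsets from 0, covers from inside
  offsets from 1.\<close>

definition grid :: "int \<Rightarrow> int \<Rightarrow> (int ^ 'n) set" where
  "grid j k = {a. \<forall>i. j \<le> a $ i \<and> a $ i < k}"

lemma bij_betw_grid:
  "bij_betw vec_nth (grid j k :: (int ^ 'n) set) (Pi\<^sub>E UNIV (\<lambda>_. {j..<k}))"
  by (rule bij_betw_byWitness[where f' = vec_lambda]) (auto simp: grid_def)

lemma finite_grid [simp]: "finite (grid j k :: (int ^ 'n) set)"
proof -
  have "finite (Pi\<^sub>E (UNIV :: 'n set) (\<lambda>_. {j..<k}))" by (intro finite_PiE) auto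
  then show ?thesis using bij_betw_finite[OF bij_betw_grid[where 'n = 'n, of j k]] by simp
qed

lemma card_grid: "card (grid j k :: (int ^ 'n) set) = nat (k - j) ^ CARD('n)"
  using bij_betw_same_card[OF bij_betw_grid[where 'n = 'n, of j k]] by (simp add: card_PiE)

lemma grid_mono: "i \<le> j \<Longrightarrow> k \<le> l \<Longrightarrow> grid j k \<subseteq> grid i l"
  unfolding grid_def by (blast intro: order_trans less_le_trans)

lemma grid_add:
  assumes "a \<in> grid 0 J" "b \<in> grid 0 J"
  shows "a + b \<in> grid 0 (2 * J)"
  unfolding grid_def
proof (clarsimp, intro conjI)
  fix i
  have "0 \<le> a $ i" "a $ i < J" "0 \<le> b $ i" "b $ i < J" using assms by (auto simp: grid_def)
  then show "0 \<le> a $ i + b $ i" "a $ i + b $ i < 2 * J" by linarith+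
qed

lemma cell_index_eq_iff:
  assumes "t > 0"
  shows "cell_index p t y = a \<longleftrightarrow> y \<in> hcube (\<chi> i. p $ i + t * of_int (a $ i)) t"
  using assms
  by (auto simp: cell_index_def hcube_def vec_eq_iff floor_eq_iff field_simps)

lemma cell_index_vimage:
  "t > 0 \<Longrightarrow> {y. cell_index p t y = a} = hcube (\<chi> i. p $ i + t * of_int (a $ i)) t"
  using cell_index_eq_iff by blast

lemma hcube_iff_grid:
  assumes "t > 0"
  shows "y \<in> hcube p (real k * t) \<longleftrightarrow> cell_index p t y \<in> grid 0 (int k)"
proof -
  have "p $ i \<le> y $ i \<longleftrightarrow> 0 \<le> \<lfloor>(y $ i - p $ i) / t\<rfloor>" for i
    using assms by (simp add: le_floor_iff zero_le_divide_iff)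
  moreover have "y $ i < p $ i + real k * t \<longleftrightarrow> \<lfloor>(y $ i - p $ i) / t\<rfloor> < int k" for i
    using assms by (simp add: floor_less_iff field_simps)
  ultimately show ?thesis by (simp add: hcube_def grid_def cell_index_def)
qed

text \<open>The corner \<open>x\<close> need not be a grid point. In each coordinate a segment of
  length \<open>m * t\<close> can then meet \<open>m + 1\<close> layers: the one of \<open>x\<close>
  and up to \<open>m\<close> later ones.\<close>

lemma hcube_subset_cells:
  assumes t: "t > 0" and y: "y \<in> hcube x (real m * t)"
  shows "cell_index p t y - cell_index p t x \<in> grid 0 (int m + 1)"
  unfolding grid_def mem_Collect_eq
proof (intro allI conjI)
  fix i
  define u v where uv: "u = (x $ i - p $ i) / t" "v = (y $ i - p $ i) / t"
  have "x $ i \<le> y $ i" "y $ i < x $ i + real m * t" using y by (auto simp: hcube_def)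
  then have "u \<le> v" "v < u + m" using t by (auto simp: uv field_simps)
  then have "\<lfloor>u\<rfloor> \<le> \<lfloor>v\<rfloor>" "\<lfloor>v\<rfloor> < \<lfloor>u\<rfloor> + int m + 1" by linarith+
  then show "0 \<le> (cell_index p t y - cell_index p t x) $ i"
    and "(cell_index p t y - cell_index p t x) $ i < int m + 1"
    by (simp_all add: cell_index_def uv)
qed

text \<open>Offset 0 may stick out below \<open>x\<close> and offset \<open>m\<close> beyond the
  opposite face; in between, at offsets 1 to \<open>m - 1\<close>, a layer is always inside.\<close>

lemma cells_subset_hcube:
  assumes t: "t > 0" and y: "cell_index p t y - cell_index p t x \<in> grid 1 (int m)"
  shows "y \<in> hcube x (real m * t)"
  unfolding hcube_def
proof (clarsimp)
  fix i
  define u v where uv: "u = (x $ i - p $ i) / t" "v = (y $ i - p $ i) / t"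
  have "1 \<le> \<lfloor>v\<rfloor> - \<lfloor>u\<rfloor>" "\<lfloor>v\<rfloor> - \<lfloor>u\<rfloor> < int m"
    using y by (auto simp: grid_def cell_index_def uv)
  then have "u \<le> v" "v < u + m" by linarith+
  then show "x $ i \<le> y $ i \<and> y $ i < x $ i + real m * t"
    using t by (auto simp: uv field_simps)
qed

lemma norm_diff_hcube:
  fixes p :: "real ^ 'n"
  assumes "y \<in> hcube p s"
  shows "norm (y - p) \<le> real CARD('n) * s"
proof -
  have coord: "\<bar>(y - p) $ i\<bar> \<le> s" for i
  proof -
    have "p $ i \<le> y $ i" "y $ i < p $ i + s" using assms by (auto simp: hcube_def)
    then show ?thesis by simp
  qed
  have "norm (y - p) \<le> (\<Sum>i\<in>UNIV. \<bar>(y - p) $ i\<bar>)" by (rule norm_le_l1_cart)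
  also have "\<dots> \<le> (\<Sum>i\<in>(UNIV :: 'n set). s)"
    using coord by (rule sum_mono)
  finally show ?thesis by simp
qed

lemma finite_hcube:
  fixes X :: "(real ^ 'n) set"
  assumes "delone X"
  shows "finite (X \<inter> hcube p s)"
proof (rule finite_subset[OF _ delone_finite_cball[OF assms]])
  show "X \<inter> hcube p s \<subseteq> X \<inter> cball p (real CARD('n) * s)"
    using norm_diff_hcube by (auto simp: dist_norm norm_minus_commute)
qed

section \<open>Counting points cell by cell\<close>

lemma card_cells:
  assumes "finite S" "\<And>a. a \<in> S \<Longrightarrow> finite (Y \<inter> {y. g y = a})"
  shows "card (Y \<inter> {y. g y \<in> S}) = (\<Sum>a\<in>S. card (Y \<inter> {y. g y = a}))"
proof -
  have "Y \<inter> {y. g y \<in> S} = (\<Union>a\<in>S. Y \<inter> {y. g y = a})" by auto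
  moreover have "card (\<Union>a\<in>S. Y \<inter> {y. g y = a}) = (\<Sum>a\<in>S. card (Y \<inter> {y. g y = a}))"
    by (rule card_UN_disjoint) (use assms in auto)
  ultimately show ?thesis by simp
qed

lemma card_hcube_grid:
  fixes Y :: "(real ^ 'n) set"
  assumes "t > 0" and fin: "\<And>p s. finite (Y \<inter> hcube p s)"
  shows "card (Y \<inter> hcube p (real k * t)) =
    (\<Sum>a\<in>grid 0 (int k). card (Y \<inter> {y. cell_index p t y = a}))"
proof -
  have "Y \<inter> hcube p (real k * t) = Y \<inter> {y. cell_index p t y \<in> grid 0 (int k)}"
    using hcube_iff_grid[OF assms(1)] by auto
  then show ?thesis
    using card_cells[of "grid 0 (int k)" Y "cell_index p t"] assms
    by (simp add: cell_index_vimage)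
qed

text \<open>Each of the \<open>k ^ n\<close> cells tiling the large cube obeys the bound, so a
  density bound uniform in position survives multiplication of the side by an integer. The next
  lemma is the dual.\<close>

lemma card_hcube_scale_lower:
  fixes Y :: "(real ^ 'n) set"
  assumes "t > 0" "\<And>p s. finite (Y \<inter> hcube p s)"
    and "\<And>p. \<alpha> * t ^ CARD('n) \<le> real (card (Y \<inter> hcube p t))"
  shows "\<alpha> * (real k * t) ^ CARD('n) \<le> real (card (Y \<inter> hcube p (real k * t)))"
proof -
  have "\<alpha> * (real k * t) ^ CARD('n) = (\<Sum>a\<in>(grid 0 (int k) :: (int ^ 'n) set). \<alpha> * t ^ CARD('n))"
    by (simp add: card_grid power_mult_distrib)
  also have "\<dots> \<le> (\<Sum>a\<in>grid 0 (int k). real (card (Y \<inter> {y. cell_index p t y = a})))"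
    by (rule sum_mono) (use assms in \<open>simp add: cell_index_vimage\<close>)
  also have "\<dots> = real (card (Y \<inter> hcube p (real k * t)))"
    using card_hcube_grid[OF assms(1,2)] by simp
  finally show ?thesis .
qed

lemma card_hcube_scale_upper:
  fixes Y :: "(real ^ 'n) set"
  assumes "t > 0" "\<And>p s. finite (Y \<inter> hcube p s)"
    and "\<And>p. real (card (Y \<inter> hcube p t)) \<le> \<beta> * t ^ CARD('n)"
  shows "real (card (Y \<inter> hcube p (real k * t))) \<le> \<beta> * (real k * t) ^ CARD('n)"
proof -
  have "real (card (Y \<inter> hcube p (real k * t))) =
      (\<Sum>a\<in>grid 0 (int k). real (card (Y \<inter> {y. cell_index p t y = a})))"
    using card_hcube_grid[OF assms(1,2)] by simp
  also have "\<dots> \<le> (\<Sum>a\<in>(grid 0 (int k) :: (int ^ 'n) set). \<beta> * t ^ CARD('n))"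
    by (rule sum_mono) (use assms in \<open>simp add: cell_index_vimage\<close>)
  also have "\<dots> = \<beta> * (real k * t) ^ CARD('n)"
    by (simp add: card_grid power_mult_distrib)
  finally show ?thesis .
qed

lemma delone_card_hcube:
  fixes X :: "(real ^ 'n) set"
  assumes "delone X"
  obtains D :: real where "D > 0"
    "\<And>p k. real (card (X \<inter> hcube p (real k))) \<le> D * real k ^ CARD('n)"
proof -
  obtain r where r: "r > 0" "\<And>c. \<exists>\<^sub>\<le>\<^sub>1 x. x \<in> X \<inter> ball c r"
    using assms unfolding delone_def by blast
  \<comment> \<open>A cube of side \<open>1 / q\<close> has diameter below \<open>r\<close> in the
    crude bound by coordinates, so it fits into a ball that holds at most one point of
    \<open>X\<close>.\<close>
  obtain q :: nat where q: "real CARD('n) / r < real q" using reals_Archimedean2 by blast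
  have "real q > 0" using q r(1) by (meson divide_nonneg_pos le_less_trans of_nat_0_le_iff)
  have small: "real CARD('n) * (1 / real q) < r"
    using q r(1) \<open>real q > 0\<close> by (simp add: field_simps)
  have one: "card (X \<inter> hcube p (1 / real q)) \<le> 1" for p
  proof -
    have "X \<inter> hcube p (1 / real q) \<subseteq> X \<inter> ball p r"
    proof
      fix y assume y: "y \<in> X \<inter> hcube p (1 / real q)"
      then have "norm (y - p) < r" using norm_diff_hcube[of y p "1 / real q"] small by auto
      then show "y \<in> X \<inter> ball p r" using y by (simp add: dist_norm norm_minus_commute)
    qed
    then have "\<forall>x\<in>X \<inter> hcube p (1 / real q). \<forall>y\<in>X \<inter> hcube p (1 / real q). x = y"
      using r(2)[of p] unfolding Uniq_def by blast
    then show ?thesis by (metis card_le_Suc0_iff_eq One_nat_def finite_hcube[OF assms])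
  qed
  \<comment> \<open>An integer side \<open>k\<close> is cut exactly into \<open>k * q\<close> pieces
    of length \<open>1 / q\<close>.\<close>
  have "real (card (X \<inter> hcube p (real k))) \<le> real q ^ CARD('n) * real k ^ CARD('n)" for p k
    using card_hcube_scale_upper[of "1 / real q" X "real q ^ CARD('n)" p "k * q"]
      \<open>real q > 0\<close> finite_hcube[OF assms] one
    by (simp add: power_divide power_mult_distrib field_simps)
  then show thesis using that[of "real q ^ CARD('n)"] \<open>real q > 0\<close> by simp
qed

section \<open>Patches and the frequency of bad points\<close>

lemma mem_centred_patch: "v \<in> centred_patch X T x \<longleftrightarrow> x + v \<in> X \<and> norm v \<le> T"
proof -
  have "v \<in> centred_patch X T x \<longleftrightarrow> (\<exists>u\<in>X. dist x u \<le> T \<and> v = u - x)"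
    by (auto simp: centred_patch_def)
  also have "\<dots> \<longleftrightarrow> x + v \<in> X \<and> norm v \<le> T"
    by (auto simp: dist_norm norm_minus_commute intro!: bexI[of _ "x + v"])
  finally show ?thesis .
qed

text \<open>Whether \<open>u\<close> is counted depends on \<open>u\<close> and on
  \<open>u + z\<close>, and both stay within distance \<open>T\<close> of the corner when
  \<open>T\<close> exceeds the diameter bound by \<open>norm z\<close>. So the count is a function
  of the patch alone.\<close>

lemma card_hcube_patch_cong:
  fixes X :: "(real ^ 'n) set"
  assumes eq: "centred_patch X T x = centred_patch X T y"
    and T: "real CARD('n) * s + norm z \<le> T"
  shows "card ({u \<in> X. u + z \<in> X} \<inter> hcube x s) = card ({u \<in> X. u + z \<in> X} \<inter> hcube y s)"
proof (rule bij_betw_same_card, rule bij_betw_byWitness)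
  have iff: "x + v \<in> X \<longleftrightarrow> y + v \<in> X" if "norm v \<le> T" for v
    using eq that by (metis mem_centred_patch)
  have key: "u + (y - x) \<in> {u \<in> X. u + z \<in> X} \<inter> hcube y s \<longleftrightarrow> u \<in> {u \<in> X. u + z \<in> X}"
    if u: "u \<in> hcube x s" for u
  proof -
    have n: "norm (u - x) \<le> real CARD('n) * s" using norm_diff_hcube[OF u] .
    have "norm (u - x + z) \<le> T" using n T norm_triangle_ineq[of "u - x" z] by linarith
    moreover have "norm (u - x) \<le> T" using n T norm_ge_zero[of z] by linarith
    ultimately show ?thesis
      using iff[of "u - x"] iff[of "u - x + z"] u by (auto simp: algebra_simps hcube_def)
  qed
  have shift: "u \<in> hcube x s \<longleftrightarrow> u + (y - x) \<in> hcube y s" for u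
    by (auto simp: hcube_def algebra_simps)
  show "(\<lambda>u. u + (y - x)) ` ({u \<in> X. u + z \<in> X} \<inter> hcube x s) \<subseteq> {u \<in> X. u + z \<in> X} \<inter> hcube y s"
    using key by blast
  show "(\<lambda>u. u - (y - x)) ` ({u \<in> X. u + z \<in> X} \<inter> hcube y s) \<subseteq> {u \<in> X. u + z \<in> X} \<inter> hcube x s"
  proof
    fix v assume "v \<in> (\<lambda>u. u - (y - x)) ` ({u \<in> X. u + z \<in> X} \<inter> hcube y s)"
    then have v: "v + (y - x) \<in> {u \<in> X. u + z \<in> X} \<inter> hcube y s" by force
    then show "v \<in> {u \<in> X. u + z \<in> X} \<inter> hcube x s" using key[of v] shift[of v] by blast
  qed
qed auto

text \<open>Double counting: after exchanging the sums, each fixed \<open>b\<close> contributes the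
  sum of \<open>f\<close> over an injective translate of \<open>G\<close> inside
  \<open>A\<close>.\<close>

lemma sum_translates_bound:
  fixes f :: "'a :: cancel_ab_semigroup_add \<Rightarrow> real"
  assumes fin: "finite A" "finite G" "finite S"
    and nonneg: "\<And>a. f a \<ge> 0"
    and sub: "\<And>a b. a \<in> G \<Longrightarrow> b \<in> S \<Longrightarrow> a + b \<in> A"
    and heavy: "\<And>a. a \<in> G \<Longrightarrow> c \<le> (\<Sum>b\<in>S. f (a + b))"
  shows "c * real (card G) \<le> real (card S) * sum f A"
proof -
  have "c * real (card G) \<le> (\<Sum>a\<in>G. \<Sum>b\<in>S. f (a + b))"
    using sum_mono[of G "\<lambda>_. c", OF heavy] by (simp add: mult.commute)
  also have "\<dots> = (\<Sum>b\<in>S. \<Sum>a\<in>G. f (a + b))" by (rule sum.swap)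
  also have "\<dots> \<le> (\<Sum>b\<in>S. sum f A)"
  proof (rule sum_mono)
    fix b assume b: "b \<in> S"
    have "(\<Sum>a\<in>G. f (a + b)) = sum f ((\<lambda>a. a + b) ` G)"
      by (subst sum.reindex) (auto simp: inj_on_def)
    also have "\<dots> \<le> sum f A" using fin(1) sub b nonneg by (intro sum_mono2) auto
    finally show "(\<Sum>a\<in>G. f (a + b)) \<le> sum f A" .
  qed
  finally show ?thesis by simp
qed

text \<open>Every patch occurs in the cube of side \<open>J t > 2 M\<close>, so the bad patches are represented by
  points in few cells of the grid.\<close>

lemma bad_patches_bound:
  fixes X :: "(real ^ 'n) set" and f :: "int ^ 'n \<Rightarrow> real"
  assumes X: "delone X" and t: "t > 0" and M: "recurrence_radius X T M" "2 * M < real J * t"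
    and S: "S \<subseteq> grid 0 (int J)"
    and f: "\<And>a. f a \<ge> 0" "sum f (grid 0 (2 * int J)) \<le> B"
    and H: "H \<subseteq> X" "\<forall>x\<in>X. \<forall>y\<in>H. centred_patch X T x = centred_patch X T y \<longrightarrow> x \<in> H"
    and heavy: "\<forall>x\<in>H. c \<le> (\<Sum>b\<in>S. f (cell_index p t x + b))"
    and D: "\<And>q. real (card (X \<inter> hcube q t)) \<le> D" and c: "c \<ge> 0"
  shows "H \<noteq> {} \<Longrightarrow> c \<le> real (card S) * B"
    and "c * real (card (centred_patch X T ` H)) \<le> real (card S) * B * D"
proof -
  \<comment> \<open>The labels in the cube of side \<open>J * t\<close> whose
    \<open>S\<close>-neighbourhood has large total weight. Heaviness refers to cells only, so it can
    be counted.\<close>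
  define G where "G = {a \<in> grid 0 (int J). c \<le> (\<Sum>b\<in>S. f (a + b))}"
  have fin: "finite S" "finite G" using S by (auto simp: G_def intro: finite_subset)
  \<comment> \<open>Neighbourhoods of cells in the cube of side \<open>J * t\<close> reach beyond it
    but stay in the cube of twice the side, which is why \<open>f\<close> is summed over the
    latter.\<close>
  have "c * real (card G) \<le> real (card S) * sum f (grid 0 (2 * int J))"
    using fin f(1) S by (intro sum_translates_bound) (auto simp: G_def intro!: grid_add)
  then have G: "c * real (card G) \<le> real (card S) * B"
    using f(2) mult_left_mono[of "sum f (grid 0 (2 * int J))" B "real (card S)"] by linarith
  have hit: "\<exists>x\<in>H. centred_patch X T x = centred_patch X T y \<and> cell_index p t x \<in> G"
    if y: "y \<in> H" for y
  proof -
    \<comment> \<open>The centre of the cube: as \<open>M < J * t / 2\<close>, the ball of radius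
      \<open>M\<close> about it lies in the cube, and every patch occurs at a point of that
      ball.\<close>
    define q where "q = (\<chi> i. p $ i + real J * t / 2)"
    obtain x where x: "x \<in> X" "dist q x \<le> M" "centred_patch X T x = centred_patch X T y"
      using M(1) y H(1) unfolding recurrence_radius_def by force
    have "x \<in> hcube p (real J * t)"
      unfolding hcube_def
    proof (intro CollectI allI)
      fix i
      have "\<bar>x $ i - q $ i\<bar> \<le> M"
        using x(2) component_le_norm_cart[of "x - q" i]
        by (simp add: dist_norm norm_minus_commute)
      then show "p $ i \<le> x $ i \<and> x $ i < p $ i + real J * t"
        using M(2) unfolding q_def by (simp add: abs_le_iff)
    qed
    then show ?thesis
      using x y H(2) heavy hcube_iff_grid[OF t] unfolding G_def by blast
  qed
  show "c \<le> real (card S) * B" if "H \<noteq> {}"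
  proof -
    have "G \<noteq> {}" using that hit by blast
    then have "card G \<ge> 1" using fin by (simp add: Suc_leI card_gt_0_iff)
    then have "c \<le> c * real (card G)" using c by (simp add: mult_le_cancel_left1)
    then show ?thesis using G by simp
  qed
  have finX: "finite (X \<inter> {y. cell_index p t y = a})" for a
    using finite_hcube[OF X] by (simp add: cell_index_vimage t)
  have "finite (\<Union>a\<in>G. X \<inter> {y. cell_index p t y = a})" using fin finX by blast
  then have finG: "finite (X \<inter> {x. cell_index p t x \<in> G})" by (rule rev_finite_subset) auto
  \<comment> \<open>Each bad patch has a representative in a cell of \<open>G\<close>, and a cell
    contains at most \<open>D\<close> points of \<open>X\<close>; hence the factor \<open>D\<close>
    between cells and patches.\<close>
  have "centred_patch X T ` H \<subseteq> centred_patch X T ` (X \<inter> {x. cell_index p t x \<in> G})"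
  proof
    fix P assume "P \<in> centred_patch X T ` H"
    then obtain x where "x \<in> H" "P = centred_patch X T x" "cell_index p t x \<in> G"
      using hit by blast
    then show "P \<in> centred_patch X T ` (X \<inter> {x. cell_index p t x \<in> G})"
      using H(1) by (intro image_eqI[of P _ x]) auto
  qed
  then have "card (centred_patch X T ` H) \<le> card (X \<inter> {x. cell_index p t x \<in> G})"
    using finG by (meson card_image_le card_mono finite_imageI le_trans)
  also have "\<dots> = (\<Sum>a\<in>G. card (X \<inter> {y. cell_index p t y = a}))"
    using card_cells[OF fin(2)] finX by blast
  finally have "real (card (centred_patch X T ` H)) \<le> (\<Sum>a\<in>G. real (card (X \<inter> {y. cell_index p t y = a})))"
    by (simp flip: of_nat_sum)
  also have "\<dots> \<le> (\<Sum>a\<in>G. D)"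
    by (rule sum_mono) (use D in \<open>simp add: cell_index_vimage t\<close>)
  finally have "real (card (centred_patch X T ` H)) \<le> real (card G) * D" by simp
  then have "c * real (card (centred_patch X T ` H)) \<le> c * real (card G) * D"
    using c mult_left_mono by (fastforce simp: mult.assoc)
  also have "\<dots> \<le> real (card S) * B * D"
    using G D[of 0] by (intro mult_right_mono) (auto intro: order_trans[OF of_nat_0_le_iff])
  finally show "c * real (card (centred_patch X T ` H)) \<le> real (card S) * B * D" .
qed

section \<open>Uniform densities\<close>

text \<open>A cube of side \<open>m * t\<close> off the grid is controlled only up to one layer of
  cells, from inside by \<open>(m - 1) ^ n\<close> and from outside by \<open>(m + 1) ^ n\<close>.
  Relative to \<open>m ^ n\<close> both tend to 1, so for large \<open>m\<close> the boundary layers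
  cost less than the gaps from \<open>\<theta>\<close> to \<open>l\<close> and
  \<open>u\<close>.\<close>

lemma wide_shape_exists:
  fixes l u :: real
  assumes "l < \<theta>" "\<theta> < u"
  obtains m :: nat where "m \<ge> 1" "l * real (m + 1) ^ n < \<theta> * real m ^ n"
    "\<theta> * real m ^ n < u * real (m - 1) ^ n"
proof -
  have "(\<lambda>m::nat. l * (1 + 1 / real m) ^ n) \<longlonglongrightarrow> l * (1 + 0) ^ n"
    by (intro tendsto_intros lim_1_over_n)
  moreover have "(\<lambda>m::nat. u * (1 - 1 / real m) ^ n) \<longlonglongrightarrow> u * (1 - 0) ^ n"
    by (intro tendsto_intros lim_1_over_n)
  ultimately have "eventually (\<lambda>m. l * (1 + 1 / real m) ^ n < \<theta> \<and> \<theta> < u * (1 - 1 / real m) ^ n \<and> m \<ge> 1)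
      sequentially"
    using assms by (intro eventually_conj order_tendstoD[where a = \<theta>] eventually_ge_at_top) auto
  then obtain m :: nat where m: "l * (1 + 1 / real m) ^ n < \<theta>" "\<theta> < u * (1 - 1 / real m) ^ n" "m \<ge> 1"
    using eventually_happens' sequentially_bot by blast
  have "1 + 1 / real m = real (m + 1) / real m" "1 - 1 / real m = real (m - 1) / real m"
    using m(3) by (auto simp: field_simps of_nat_diff)
  then have "l * real (m + 1) ^ n < \<theta> * real m ^ n" "\<theta> * real m ^ n < u * real (m - 1) ^ n"
    using m by (auto simp: power_divide field_simps)
  then show thesis using that m(3) by blast
qed

lemma card_cells_le_hcube:
  fixes Y :: "(real ^ 'n) set"
  assumes t: "t > 0" and fin: "\<And>p s. finite (Y \<inter> hcube p s)"
  shows "(\<Sum>b\<in>grid 1 (int m). card (Y \<inter> {y. cell_index p t y = cell_index p t x + b}))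
           \<le> card (Y \<inter> hcube x (real m * t))"
    and "card (Y \<inter> hcube x (real m * t))
           \<le> (\<Sum>b\<in>grid 0 (int m + 1). card (Y \<inter> {y. cell_index p t y = cell_index p t x + b}))"
proof -
  let ?g = "\<lambda>y. cell_index p t y - cell_index p t x"
  have eq: "{y. ?g y = b} = {y. cell_index p t y = cell_index p t x + b}" for b
    by (auto simp: algebra_simps)
  have finc: "finite (Y \<inter> {y. ?g y = b})" for b
    using fin t by (simp add: eq cell_index_vimage)
  have sums: "card (Y \<inter> {y. ?g y \<in> grid i j}) =
      (\<Sum>b\<in>grid i j. card (Y \<inter> {y. cell_index p t y = cell_index p t x + b}))" for i j
    using card_cells[of "grid i j" Y ?g] finc by (simp add: eq)
  have "finite (\<Union>b\<in>grid 0 (int m + 1). Y \<inter> {y. ?g y = b})"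
    using finc by (intro finite_UN_I) auto
  then have "finite (Y \<inter> {y. ?g y \<in> grid 0 (int m + 1)})" by (rule rev_finite_subset) auto
  then have "card (Y \<inter> hcube x (real m * t)) \<le> card (Y \<inter> {y. ?g y \<in> grid 0 (int m + 1)})"
    using hcube_subset_cells[OF t] by (intro card_mono) blast+
  then show "card (Y \<inter> hcube x (real m * t))
      \<le> (\<Sum>b\<in>grid 0 (int m + 1). card (Y \<inter> {y. cell_index p t y = cell_index p t x + b}))"
    by (simp only: sums)
  have "card (Y \<inter> {y. ?g y \<in> grid 1 (int m)}) \<le> card (Y \<inter> hcube x (real m * t))"
    using cells_subset_hcube[OF t] fin by (intro card_mono) blast+
  then show "(\<Sum>b\<in>grid 1 (int m). card (Y \<inter> {y. cell_index p t y = cell_index p t x + b}))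
      \<le> card (Y \<inter> hcube x (real m * t))"
    by (simp only: sums)
qed

text \<open>A point \<open>x\<close> is bad for the lower density \<open>l\<close> if the cube of side \<open>m t\<close> at \<open>x\<close> has density at
  least \<open>\<theta>\<close>, and bad for the upper density \<open>u\<close> if it has density at most \<open>\<theta>\<close>.  Every point is bad for
  one of the two.\<close>

lemma patch_count_bound_at_scale:
  fixes X :: "(real ^ 'n) set" and m :: nat and t :: real
  defines "Y \<equiv> \<lambda>z. {x \<in> X. x + z \<in> X}"
  assumes X: "delone X" and t: "t > 0" and M: "recurrence_radius X T M" "2 * M < real J * t"
    and m: "m \<ge> 1" "m + 1 \<le> J" and T: "real CARD('n) * (real m * t) + norm z \<le> T"
    and \<gamma>: "\<gamma> > 0" "\<gamma> \<le> \<theta> * real m ^ CARD('n) - l * real (m + 1) ^ CARD('n)"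
      "\<gamma> \<le> u * real (m - 1) ^ CARD('n) - \<theta> * real m ^ CARD('n)"
    and D: "\<And>q. real (card (X \<inter> hcube q t)) \<le> D * t ^ CARD('n)"
    and \<epsilon>: "\<epsilon> > 0"
    and low: "\<And>q. (l - \<epsilon>) * t ^ CARD('n) \<le> real (card (Y z \<inter> hcube q t))"
      "real (card (Y z \<inter> hcube p (real (2 * J) * t))) \<le> (l + \<epsilon>) * (real (2 * J) * t) ^ CARD('n)"
    and high: "\<And>q. real (card (Y z \<inter> hcube q t)) \<le> (u + \<epsilon>) * t ^ CARD('n)"
      "real (card (Y z \<inter> hcube p' (real (2 * J) * t))) \<ge> (u - \<epsilon>) * (real (2 * J) * t) ^ CARD('n)"
  defines "\<kappa> \<equiv> real (m + 1) ^ CARD('n) * 2 ^ CARD('n) * 2 / \<gamma>"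
  shows "1 \<le> \<kappa> * \<epsilon> * real J ^ CARD('n)"
    and "real (patch_count X T) \<le> 2 * D * \<kappa> * \<epsilon> * (real J * t) ^ CARD('n)"
proof -
  let ?n = "CARD('n)"
  \<comment> \<open>The total slack in the doubled cube: its density and the guaranteed density of
    its cells differ by at most \<open>2 * \<epsilon>\<close>.\<close>
  define B where "B = 2 * \<epsilon> * (real (2 * J) * t) ^ ?n"
  \<comment> \<open>The slack that a single bad cube of side \<open>m * t\<close> forces on the
    cells around it.\<close>
  define c where "c = \<gamma> * t ^ ?n"
  have tn: "t ^ ?n > 0" using t by simp
  have c: "c > 0" using \<gamma>(1) tn by (simp add: c_def)
  have B: "B \<ge> 0" using \<epsilon> t by (simp add: B_def)
  have D0: "D * t ^ ?n \<ge> 0" using D[of 0] by (rule order_trans[OF of_nat_0_le_iff])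
  have finY: "finite (Y z \<inter> hcube q s)" for q s
    by (rule finite_subset[OF _ finite_hcube[OF X, of q s]]) (auto simp: Y_def)
  define w where "w = (\<lambda>p a. real (card (Y z \<inter> {y. cell_index p t y = a})))"
  have w_total: "sum (w p) (grid 0 (2 * int J)) = real (card (Y z \<inter> hcube p (real (2 * J) * t)))" for p
    using card_hcube_grid[OF t finY, of p "2 * J"] by (simp add: w_def)
  have w_low: "(l - \<epsilon>) * t ^ ?n \<le> w p a" and w_high: "w p a \<le> (u + \<epsilon>) * t ^ ?n" for p a
    using low(1) high(1) by (auto simp: w_def cell_index_vimage t)
  define v where "v = (\<lambda>x. real (card (Y z \<inter> hcube x (real m * t))))"
  have v_le: "v x \<le> (\<Sum>b\<in>grid 0 (int m + 1). w p (cell_index p t x + b))"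
    and v_ge: "(\<Sum>b\<in>grid 1 (int m). w p (cell_index p t x + b)) \<le> v x" for x p
    using card_cells_le_hcube[OF t finY, where m = m and p = p and x = x] unfolding v_def w_def
    by (simp_all flip: of_nat_sum)
  have v_cong: "v x = v y" if "centred_patch X T x = centred_patch X T y" for x y
    using card_hcube_patch_cong[OF that T] by (simp add: v_def Y_def)
  define H1 where "H1 = {x \<in> X. \<theta> * (real m * t) ^ ?n \<le> v x}"
  define H2 where "H2 = {x \<in> X. v x \<le> \<theta> * (real m * t) ^ ?n}"
  have shape: "grid 0 (int m + 1) \<subseteq> grid 0 (int J)" "grid 1 (int m) \<subseteq> grid 0 (int J)"
    using m by (intro grid_mono; simp)+
  have H1: "H1 \<noteq> {} \<Longrightarrow> c \<le> real (card (grid 0 (int m + 1) :: (int ^ 'n) set)) * B"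
    "c * real (card (centred_patch X T ` H1)) \<le>
      real (card (grid 0 (int m + 1) :: (int ^ 'n) set)) * B * (D * t ^ ?n)"
  proof -
    \<comment> \<open>The excess of a cell over the guaranteed minimum. A cube of density at least
      \<open>\<theta>\<close> is covered by \<open>(m + 1) ^ n\<close> cells, whose common excess is
      then at least \<open>c\<close>.\<close>
    define f where "f = (\<lambda>a. w p a - (l - \<epsilon>) * t ^ ?n)"
    have f: "f a \<ge> 0" for a using w_low by (simp add: f_def)
    have "sum f (grid 0 (2 * int J)) =
        real (card (Y z \<inter> hcube p (real (2 * J) * t))) - (l - \<epsilon>) * (real (2 * J) * t) ^ ?n"
      using w_total[of p] by (simp add: f_def sum_subtractf card_grid power_mult_distrib nat_mult_distrib)
    also have "\<dots> \<le> B" using low(2) by (simp add: B_def algebra_simps)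
    finally have fB: "sum f (grid 0 (2 * int J)) \<le> B" .
    have heavy: "c \<le> (\<Sum>b\<in>grid 0 (int m + 1). f (cell_index p t x + b))" if "x \<in> H1" for x
    proof -
      have "c \<le> \<theta> * (real m * t) ^ ?n - l * (real (m + 1) ^ ?n * t ^ ?n)"
        using mult_right_mono[OF \<gamma>(2), of "t ^ ?n"] tn by (simp add: c_def algebra_simps)
      also have "\<dots> \<le> v x - (l - \<epsilon>) * (real (m + 1) ^ ?n * t ^ ?n)"
        using that \<epsilon> tn by (intro diff_mono mult_right_mono) (auto simp: H1_def)
      also have "\<dots> \<le> (\<Sum>b\<in>grid 0 (int m + 1). w p (cell_index p t x + b)) -
          (l - \<epsilon>) * (real (m + 1) ^ ?n * t ^ ?n)"
        using v_le by simp
      also have "\<dots> = (\<Sum>b\<in>grid 0 (int m + 1). f (cell_index p t x + b))"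
        by (simp add: f_def sum_subtractf card_grid nat_add_distrib)
      finally show ?thesis .
    qed
    have cong: "\<forall>x\<in>X. \<forall>y\<in>H1. centred_patch X T x = centred_patch X T y \<longrightarrow> x \<in> H1"
      by (auto simp: H1_def dest: v_cong)
    have "H1 \<subseteq> X" by (auto simp: H1_def)
    note bnd = bad_patches_bound[OF X t M shape(1) f fB this cong ballI[OF heavy] D less_imp_le[OF c]]
    show "H1 \<noteq> {} \<Longrightarrow> c \<le> real (card (grid 0 (int m + 1) :: (int ^ 'n) set)) * B"
      "c * real (card (centred_patch X T ` H1)) \<le>
        real (card (grid 0 (int m + 1) :: (int ^ 'n) set)) * B * (D * t ^ ?n)"
      using bnd by blast+
  qed
  have H2: "H2 \<noteq> {} \<Longrightarrow> c \<le> real (card (grid 1 (int m) :: (int ^ 'n) set)) * B"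
    "c * real (card (centred_patch X T ` H2)) \<le>
      real (card (grid 1 (int m) :: (int ^ 'n) set)) * B * (D * t ^ ?n)"
  proof -
    \<comment> \<open>Dually, the deficit of a cell below the guaranteed maximum. Now only the cells
      inside the cube are used, since a small count in the cube bounds the counts of those.\<close>
    define f where "f = (\<lambda>a. (u + \<epsilon>) * t ^ ?n - w p' a)"
    have f: "f a \<ge> 0" for a using w_high by (simp add: f_def)
    have "sum f (grid 0 (2 * int J)) =
        (u + \<epsilon>) * (real (2 * J) * t) ^ ?n - real (card (Y z \<inter> hcube p' (real (2 * J) * t)))"
      using w_total[of p'] by (simp add: f_def sum_subtractf card_grid power_mult_distrib nat_mult_distrib)
    also have "\<dots> \<le> B" using high(2) by (simp add: B_def algebra_simps)
    finally have fB: "sum f (grid 0 (2 * int J)) \<le> B" .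
    have heavy: "c \<le> (\<Sum>b\<in>grid 1 (int m). f (cell_index p' t x + b))" if "x \<in> H2" for x
    proof -
      have "c \<le> u * (real (m - 1) ^ ?n * t ^ ?n) - \<theta> * (real m * t) ^ ?n"
        using mult_right_mono[OF \<gamma>(3), of "t ^ ?n"] tn by (simp add: c_def algebra_simps)
      also have "\<dots> \<le> (u + \<epsilon>) * (real (m - 1) ^ ?n * t ^ ?n) - v x"
        using that \<epsilon> tn by (intro diff_mono mult_right_mono) (auto simp: H2_def)
      also have "\<dots> \<le> (u + \<epsilon>) * (real (m - 1) ^ ?n * t ^ ?n) -
          (\<Sum>b\<in>grid 1 (int m). w p' (cell_index p' t x + b))"
        using v_ge by simp
      also have "\<dots> = (\<Sum>b\<in>grid 1 (int m). f (cell_index p' t x + b))"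
        using m(1) by (simp add: f_def sum_subtractf card_grid nat_diff_distrib of_nat_diff)
      finally show ?thesis .
    qed
    have cong: "\<forall>x\<in>X. \<forall>y\<in>H2. centred_patch X T x = centred_patch X T y \<longrightarrow> x \<in> H2"
      by (auto simp: H2_def dest: v_cong)
    have "H2 \<subseteq> X" by (auto simp: H2_def)
    note bnd = bad_patches_bound[OF X t M shape(2) f fB this cong ballI[OF heavy] D less_imp_le[OF c]]
    show "H2 \<noteq> {} \<Longrightarrow> c \<le> real (card (grid 1 (int m) :: (int ^ 'n) set)) * B"
      "c * real (card (centred_patch X T ` H2)) \<le>
        real (card (grid 1 (int m) :: (int ^ 'n) set)) * B * (D * t ^ ?n)"
      using bnd by blast+
  qed
  have "nat (int m - 1) \<le> m + 1" by simp
  then have card_le: "real (card (grid 0 (int m + 1) :: (int ^ 'n) set)) \<le> real (m + 1) ^ ?n"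
    "real (card (grid 1 (int m) :: (int ^ 'n) set)) \<le> real (m + 1) ^ ?n"
    unfolding card_grid of_nat_power by (intro power_mono; simp)+
  \<comment> \<open>In \<open>\<kappa>\<close>, the power of \<open>m + 1\<close> bounds both
    neighbourhood shapes, \<open>2 ^ n\<close> comes from doubling the cube, the factor 2 from
    \<open>B\<close> and \<open>1 / \<gamma>\<close> from \<open>c\<close>.\<close>
  have \<kappa>: "real (m + 1) ^ ?n * B = c * (\<kappa> * \<epsilon> * real J ^ ?n)"
    using \<gamma>(1) by (simp add: B_def c_def \<kappa>_def power_mult_distrib field_simps)
  \<comment> \<open>Some point is bad in one of the two senses, which gives the first claim. Every
    patch belongs to a bad point, so adding the two patch bounds gives the second claim with its
    factor 2.\<close>
  have split: "X = H1 \<union> H2" by (auto simp: H1_def H2_def)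
  have "X \<noteq> {}" using X unfolding delone_def by blast
  then have "c \<le> real (m + 1) ^ ?n * B"
    using split H1(1) H2(1) card_le mult_right_mono[OF _ B] by (metis Un_empty order_trans)
  then have "c * 1 \<le> c * (\<kappa> * \<epsilon> * real J ^ ?n)" by (simp only: \<kappa> mult_1_right)
  then show "1 \<le> \<kappa> * \<epsilon> * real J ^ ?n" using c by (simp only: mult_le_cancel_left_pos)
  have bound: "real (card (centred_patch X T ` H)) \<le> \<kappa> * \<epsilon> * real J ^ ?n * (D * t ^ ?n)"
    if "c * real (card (centred_patch X T ` H)) \<le> k * B * (D * t ^ ?n)" "k \<le> real (m + 1) ^ ?n" for H k
  proof -
    have "k * B * (D * t ^ ?n) \<le> real (m + 1) ^ ?n * B * (D * t ^ ?n)"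
      using that(2) B D0 by (intro mult_right_mono)
    also have "\<dots> = c * (\<kappa> * \<epsilon> * real J ^ ?n * (D * t ^ ?n))" by (simp only: \<kappa> mult.assoc)
    finally show ?thesis using that(1) c by (meson mult_le_cancel_left_pos order_trans)
  qed
  have "patch_count X T \<le> card (centred_patch X T ` H1) + card (centred_patch X T ` H2)"
    unfolding patch_count_def by (metis card_Un_le image_Un split)
  then show "real (patch_count X T) \<le> 2 * D * \<kappa> * \<epsilon> * (real J * t) ^ ?n"
    using bound[OF H1(2) card_le(1)] bound[OF H2(2) card_le(2)]
    by (simp add: power_mult_distrib algebra_simps)
qed

text \<open>The bounds at one scale carry a factor \<open>\<epsilon>\<close> whose coefficient is
  independent of \<open>\<epsilon>\<close> and of the scale. Linear repetitivity keeps
  \<open>J\<close> bounded, dense repetitivity makes \<open>M ^ n\<close> at most a multiple of the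
  number of patches; in either case a small \<open>\<epsilon>\<close> is impossible.\<close>

lemma uniform_density_contradiction:
  fixes X :: "(real ^ 'n) set" and l u :: real
  defines "Y \<equiv> \<lambda>z. {x \<in> X. x + z \<in> X}"
  assumes X: "delone X" and rep: "linearly_repetitive X \<or> densely_repetitive X" and lu: "l < u"
    and scale: "\<And>\<epsilon> k0. \<epsilon> > 0 \<Longrightarrow> \<exists>k\<ge>k0. k > 0 \<and>
      (\<forall>q. (l - \<epsilon>) * real k ^ CARD('n) \<le> real (card (Y z \<inter> hcube q (real k))) \<and>
        real (card (Y z \<inter> hcube q (real k))) \<le> (u + \<epsilon>) * real k ^ CARD('n))"
    and low: "\<And>\<epsilon> k. \<epsilon> > 0 \<Longrightarrow> k > 0 \<Longrightarrow>
      \<exists>p. real (card (Y z \<inter> hcube p (real k))) \<le> (l + \<epsilon>) * real k ^ CARD('n)"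
    and high: "\<And>\<epsilon> k. \<epsilon> > 0 \<Longrightarrow> k > 0 \<Longrightarrow>
      \<exists>p. real (card (Y z \<inter> hcube p (real k))) \<ge> (u - \<epsilon>) * real k ^ CARD('n)"
  shows False
proof -
  let ?n = "CARD('n)"
  obtain \<theta> where \<theta>: "l < \<theta>" "\<theta> < u" using lu dense by blast
  obtain m :: nat where m: "m \<ge> 1" "l * real (m + 1) ^ ?n < \<theta> * real m ^ ?n"
    "\<theta> * real m ^ ?n < u * real (m - 1) ^ ?n"
    using wide_shape_exists[OF \<theta>, of ?n] by blast
  define \<gamma> where "\<gamma> = min (\<theta> * real m ^ ?n - l * real (m + 1) ^ ?n)
    (u * real (m - 1) ^ ?n - \<theta> * real m ^ ?n)"
  have \<gamma>: "\<gamma> > 0" "\<gamma> \<le> \<theta> * real m ^ ?n - l * real (m + 1) ^ ?n"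
    "\<gamma> \<le> u * real (m - 1) ^ ?n - \<theta> * real m ^ ?n"
    using m by (auto simp: \<gamma>_def)
  obtain D :: real where D: "D > 0" "\<And>p k. real (card (X \<inter> hcube p (real k))) \<le> D * real k ^ ?n"
    using delone_card_hcube[OF X] by blast
  define \<kappa>0 where "\<kappa>0 = real (m + 1) ^ ?n * 2 ^ ?n * 2 / \<gamma>"
  \<comment> \<open>\<open>2 * D + 1\<close> dominates both 1 and \<open>2 * D\<close>, so one
    constant serves both bounds; the power of \<open>m + 3\<close> comes from estimating
    \<open>J\<close> by \<open>(m + 3) * (M / t + 1)\<close>.\<close>
  define \<kappa> where "\<kappa> = (2 * D + 1) * \<kappa>0 * real (m + 3) ^ ?n"
  have \<kappa>0: "\<kappa>0 > 0" using \<gamma>(1) by (simp add: \<kappa>0_def)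
  have \<kappa>: "\<kappa> > 0" using \<kappa>0 D(1) by (simp add: \<kappa>_def)
  \<comment> \<open>Patches of radius \<open>a * t\<close> see a cube of side \<open>m * t\<close>
    and its shift by \<open>z\<close>: the summand 1 pays for \<open>z\<close> once
    \<open>norm z \<le> t\<close>.\<close>
  define a where "a = real ?n * real m + 1"
  have a: "a \<ge> 1" by (simp add: a_def)
  have repetitive: "repetitive X"
    using rep by (auto simp: linearly_repetitive_def densely_repetitive_def)
  have key: "\<exists>k\<ge>k0. k > 0 \<and>
      1 \<le> \<kappa> * \<epsilon> * (repetitivity X (a * real k) / real k + 1) ^ ?n \<and>
      real (patch_count X (a * real k)) \<le> \<kappa> * \<epsilon> * (repetitivity X (a * real k) + real k) ^ ?n"
    if \<epsilon>: "\<epsilon> > 0" for \<epsilon> :: real and k0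
  proof -
    obtain k where k: "k \<ge> max k0 (nat \<lceil>norm z\<rceil>)" "k > 0"
      and dens: "\<And>q. (l - \<epsilon>) * real k ^ ?n \<le> real (card (Y z \<inter> hcube q (real k)))"
        "\<And>q. real (card (Y z \<inter> hcube q (real k))) \<le> (u + \<epsilon>) * real k ^ ?n"
      using scale[OF \<epsilon>] by blast
    define t where "t = real k"
    define M where "M = repetitivity X (a * t)"
    have t: "t > 0" "norm z \<le> t" using k by (auto simp: t_def nat_ceiling_le_eq)
    have recM: "recurrence_radius X (a * t) M"
      using recurrence_radius_repetitivity(1)[OF X repetitive] t a by (simp add: M_def)
    then have M: "M > 0" by (simp add: recurrence_radius_def)
    \<comment> \<open>Large enough for \<open>J * t > 2 * M\<close> and for the neighbourhoods to
      fit, yet of order \<open>M / t + 1\<close>.\<close>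
    define J where "J = nat \<lceil>2 * M / t\<rceil> + m + 2"
    have J: "2 * M / t < real J" "real J \<le> 2 * M / t + 1 + m + 2" "m + 1 \<le> J"
      using M t by (auto simp: J_def) linarith+
    then have JM: "2 * M < real J * t" using t by (simp add: field_simps)
    have "real J \<le> real (m + 3) * (M / t + 1)"
    proof -
      have "2 * (M / t) \<le> real (m + 3) * (M / t)" using M t by (intro mult_right_mono) auto
      then show ?thesis using J(2) by (simp add: algebra_simps)
    qed
    then have Jn: "real J ^ ?n \<le> real (m + 3) ^ ?n * (M / t + 1) ^ ?n"
      by (simp flip: power_mult_distrib add: power_mono)
    have Jt: "(real J * t) ^ ?n \<le> real (m + 3) ^ ?n * (M + t) ^ ?n"
    proof -
      have "real J * t \<le> real (m + 3) * (M / t + 1) * t"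
        using \<open>real J \<le> real (m + 3) * (M / t + 1)\<close> t(1) by (intro mult_right_mono) auto
      also have "\<dots> = real (m + 3) * (M + t)" using t(1) by (simp add: field_simps)
      finally show ?thesis using t(1) by (simp flip: power_mult_distrib add: power_mono)
    qed
    have T: "real ?n * (real m * t) + norm z \<le> a * t" using t by (simp add: a_def algebra_simps)
    \<comment> \<open>The doubled cube has an integer side, so cubes of nearly extreme density exist
      at exactly this size.\<close>
    have kJ: "real (2 * J) * t = real (2 * J * k)" "2 * J * k > 0"
      using k(2) J(3) by (simp_all add: t_def)
    obtain p where p: "real (card (Y z \<inter> hcube p (real (2 * J) * t))) \<le> (l + \<epsilon>) * (real (2 * J) * t) ^ ?n"
      using low[OF \<epsilon> kJ(2)] unfolding kJ(1) by blast
    obtain p' where p': "real (card (Y z \<inter> hcube p' (real (2 * J) * t))) \<ge> (u - \<epsilon>) * (real (2 * J) * t) ^ ?n"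
      using high[OF \<epsilon> kJ(2)] unfolding kJ(1) by blast
    note bnd = patch_count_bound_at_scale[OF X t(1) recM JM m(1) J(3) T \<gamma> D(2)[of _ k, folded t_def] \<epsilon>
      dens(1)[unfolded Y_def, folded t_def] p[unfolded Y_def]
      dens(2)[unfolded Y_def, folded t_def] p'[unfolded Y_def], folded \<kappa>0_def]
    have "1 \<le> \<kappa>0 * \<epsilon> * real J ^ ?n" by (rule bnd(1))
    also have "\<dots> \<le> \<kappa>0 * \<epsilon> * (real (m + 3) ^ ?n * (M / t + 1) ^ ?n)"
      using Jn \<kappa>0 \<epsilon> by (intro mult_left_mono) auto
    also have "\<dots> \<le> (2 * D + 1) * (\<kappa>0 * \<epsilon> * (real (m + 3) ^ ?n * (M / t + 1) ^ ?n))"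
      using mult_right_mono[of 1 "2 * D + 1" "\<kappa>0 * \<epsilon> * (real (m + 3) ^ ?n * (M / t + 1) ^ ?n)"]
        D(1) \<kappa>0 \<epsilon> M t(1) by simp
    finally have 1: "1 \<le> \<kappa> * \<epsilon> * (M / t + 1) ^ ?n" by (simp add: \<kappa>_def mult_ac)
    have "real (patch_count X (a * t)) \<le> 2 * D * \<kappa>0 * \<epsilon> * (real J * t) ^ ?n" by (rule bnd(2))
    also have "\<dots> \<le> 2 * D * \<kappa>0 * \<epsilon> * (real (m + 3) ^ ?n * (M + t) ^ ?n)"
      using Jt \<kappa>0 \<epsilon> D(1) by (intro mult_left_mono) auto
    also have "\<dots> \<le> (2 * D + 1) * \<kappa>0 * \<epsilon> * (real (m + 3) ^ ?n * (M + t) ^ ?n)"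
      using \<kappa>0 \<epsilon> M t(1) by (intro mult_right_mono) auto
    finally have "real (patch_count X (a * t)) \<le> \<kappa> * \<epsilon> * (M + t) ^ ?n" by (simp add: \<kappa>_def mult_ac)
    then show ?thesis using 1 k unfolding M_def t_def by auto
  qed
  have large: "a * real k \<ge> T0" if "k \<ge> nat \<lceil>T0\<rceil>" for T0 k
  proof -
    have "T0 \<le> real k" using that by (simp add: nat_ceiling_le_eq)
    also have "\<dots> \<le> a * real k" using a by (simp add: mult_le_cancel_right1)
    finally show ?thesis .
  qed
  have Mpos: "repetitivity X (a * real k) > 0" if "k > 0" for k :: nat
    using recurrence_radius_repetitivity(1)[OF X repetitive, of "a * real k"] that a
    by (simp add: recurrence_radius_def)
  have Npos: "patch_count X (a * real k) > 0" if "k > 0" for k :: nat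
  proof -
    have "X \<noteq> {}" using X unfolding delone_def by blast
    then show ?thesis
      using finite_patches[OF X repetitive, of "a * real k"] that a
      by (simp add: patch_count_def card_gt_0_iff)
  qed
  show False
    using rep
  proof
    assume "linearly_repetitive X"
    then have "repetitivity X \<in> O[at_top](\<lambda>T. T)" by (simp add: linearly_repetitive_def)
    then obtain C T0 where C: "C > 0" "\<And>T. T \<ge> T0 \<Longrightarrow> \<bar>repetitivity X T\<bar> \<le> C * \<bar>T\<bar>"
      by (elim landau_o.bigE) (auto simp: eventually_at_top_linorder)
    \<comment> \<open>Chosen so that \<open>\<kappa> * \<epsilon> * (C * a + 1) ^ n\<close> is
      \<open>1 / 2\<close>, against the lower bound 1.\<close>
    define \<epsilon> where "\<epsilon> = 1 / (2 * \<kappa> * (C * a + 1) ^ ?n)"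
    have Ca: "C * a + 1 > 0" using C(1) a by (simp add: add_pos_pos)
    have \<epsilon>: "\<epsilon> > 0" using \<kappa> Ca by (simp add: \<epsilon>_def)
    obtain k where k: "k \<ge> nat \<lceil>T0\<rceil>" "k > 0"
      "1 \<le> \<kappa> * \<epsilon> * (repetitivity X (a * real k) / real k + 1) ^ ?n"
      using key[OF \<epsilon>] by blast
    have "repetitivity X (a * real k) \<le> C * (a * real k)"
      using C(2)[OF large[OF k(1)]] a by (simp add: abs_le_iff abs_mult)
    then have "repetitivity X (a * real k) / real k + 1 \<le> C * a + 1"
      using k(2) by (simp add: field_simps)
    then have "(repetitivity X (a * real k) / real k + 1) ^ ?n \<le> (C * a + 1) ^ ?n"
      using Mpos[OF k(2)] by (intro power_mono) auto
    then have "\<kappa> * \<epsilon> * (repetitivity X (a * real k) / real k + 1) ^ ?n \<le> \<kappa> * \<epsilon> * (C * a + 1) ^ ?n"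
      using \<kappa> \<epsilon> by (intro mult_left_mono) auto
    also have "\<dots> = 1 / 2" using \<kappa> Ca by (simp add: \<epsilon>_def)
    finally show False using k(3) by simp
  next
    assume "densely_repetitive X"
    then have "repetitivity X \<in> O[at_top](\<lambda>T. real (patch_count X T) powr (1 / real ?n))"
      by (simp add: densely_repetitive_def)
    then obtain C T0 where C: "C > 0"
      "\<And>T. T \<ge> T0 \<Longrightarrow> \<bar>repetitivity X T\<bar> \<le> C * real (patch_count X T) powr (1 / real ?n)"
      by (elim landau_o.bigE) (auto simp: eventually_at_top_linorder)
    \<comment> \<open>Chosen to make \<open>\<kappa> * \<epsilon> * 2 ^ n\<close> smaller than 1,
      and still smaller than 1 after multiplication by \<open>C ^ n\<close>.\<close>
    define \<epsilon> where "\<epsilon> = 1 / (2 * \<kappa> * 2 ^ ?n * (C ^ ?n + 1))"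
    have Cn: "C ^ ?n > 0" using C(1) by simp
    have \<epsilon>: "\<epsilon> > 0" using \<kappa> Cn by (simp add: \<epsilon>_def add_pos_pos)
    have \<kappa>\<epsilon>: "\<kappa> * \<epsilon> * 2 ^ ?n = 1 / (2 * (C ^ ?n + 1))"
      using \<kappa> Cn by (simp add: \<epsilon>_def)
    obtain k where k: "k \<ge> nat \<lceil>T0\<rceil>" "k > 0"
      "1 \<le> \<kappa> * \<epsilon> * (repetitivity X (a * real k) / real k + 1) ^ ?n"
      "real (patch_count X (a * real k)) \<le> \<kappa> * \<epsilon> * (repetitivity X (a * real k) + real k) ^ ?n"
      using key[OF \<epsilon>] by blast
    define M N where "M = repetitivity X (a * real k)" "N = real (patch_count X (a * real k))"
    have M: "M > 0" "M \<le> C * N powr (1 / real ?n)"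
      using Mpos[OF k(2)] C(2)[OF large[OF k(1)]] by (auto simp: M_N_def)
    have N: "N > 0" using Npos[OF k(2)] by (simp add: M_N_def)
    show False
    \<comment> \<open>If \<open>M\<close> is at most the scale, the number of cells is bounded and
      the first bound fails as in the linear case. Otherwise \<open>M + k \<le> 2 * M\<close>, and
      the patch bound combined with \<open>M ^ n \<le> C ^ n * N\<close> gives
      \<open>N < N\<close>.\<close>
    proof (cases "M \<le> real k")
      case True
      then have "(M / real k + 1) ^ ?n \<le> 2 ^ ?n" using k(2) M(1) by (intro power_mono) auto
      then have "\<kappa> * \<epsilon> * (M / real k + 1) ^ ?n \<le> \<kappa> * \<epsilon> * 2 ^ ?n"
        using \<kappa> \<epsilon> by (intro mult_left_mono) auto
      also have "\<dots> < 1" using Cn by (simp add: \<kappa>\<epsilon>)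
      finally show False using k(3) by (simp add: M_N_def)
    next
      case False
      have "M ^ ?n \<le> (C * N powr (1 / real ?n)) ^ ?n" using M by (intro power_mono) auto
      also have "\<dots> = C ^ ?n * N"
        using N by (simp add: power_mult_distrib powr_powr flip: powr_realpow)
      finally have MN: "M ^ ?n \<le> C ^ ?n * N" .
      have "(M + real k) ^ ?n \<le> (2 * M) ^ ?n" using False M by (intro power_mono) auto
      then have "\<kappa> * \<epsilon> * (M + real k) ^ ?n \<le> \<kappa> * \<epsilon> * (2 * M) ^ ?n"
        using \<kappa> \<epsilon> by (intro mult_left_mono) auto
      then have "N \<le> \<kappa> * \<epsilon> * (2 * M) ^ ?n" using k(4) by (simp add: M_N_def)
      also have "\<dots> = \<kappa> * \<epsilon> * 2 ^ ?n * M ^ ?n" by (simp add: power_mult_distrib)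
      also have "\<dots> \<le> \<kappa> * \<epsilon> * 2 ^ ?n * (C ^ ?n * N)"
        using MN \<kappa> \<epsilon> by (intro mult_left_mono) auto
      also have "\<dots> = N * (C ^ ?n / (2 * (C ^ ?n + 1)))" by (simp add: \<kappa>\<epsilon>)
      also have "\<dots> < N * 1" using N Cn by (intro mult_strict_left_mono) (auto simp: field_simps)
      finally show False by simp
    qed
  qed
qed

text \<open>Take \<open>l\<close> as the supremum of the lower density bounds valid at some integer
  side, uniformly in position, and \<open>u\<close> as the infimum of the upper ones. Such bounds
  persist at multiples of the side, so approximations to \<open>l\<close> and \<open>u\<close> hold
  at a common, arbitrarily large scale, where repetitivity forces \<open>u \<le> l\<close>.\<close>

lemma uniform_density:
  fixes X :: "(real ^ 'n) set"
  defines "Y \<equiv> \<lambda>z. {x \<in> X. x + z \<in> X}"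
  assumes X: "delone X" and rep: "linearly_repetitive X \<or> densely_repetitive X"
  obtains d where "\<And>e. e > 0 \<Longrightarrow> \<exists>t>0. \<forall>p.
    (d - e) * t ^ CARD('n) \<le> real (card (Y z \<inter> hcube p t)) \<and>
    real (card (Y z \<inter> hcube p t)) \<le> (d + e) * t ^ CARD('n)"
proof -
  let ?n = "CARD('n)"
  have finY: "finite (Y z \<inter> hcube q s)" for q s
    by (rule finite_subset[OF _ finite_hcube[OF X, of q s]]) (auto simp: Y_def)
  have Yz: "Y z = {x \<in> X. x + z \<in> X}" by (simp add: Y_def)
  define lower where "lower = (\<lambda>\<alpha> k. \<forall>p. \<alpha> * real k ^ ?n \<le> real (card (Y z \<inter> hcube p (real k))))"
  define upper where "upper = (\<lambda>\<beta> k. \<forall>p. real (card (Y z \<inter> hcube p (real k))) \<le> \<beta> * real k ^ ?n)"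
  have lower_scale: "lower \<alpha> (j * k)" if "k > 0" "lower \<alpha> k" for \<alpha> j k
    using card_hcube_scale_lower[of "real k" "Y z" \<alpha>, where k = j] that finY by (simp add: lower_def)
  have upper_scale: "upper \<beta> (j * k)" if "k > 0" "upper \<beta> k" for \<beta> j k
    using card_hcube_scale_upper[of "real k" "Y z" \<beta>, where k = j] that finY by (simp add: upper_def)
  have lower_mono: "lower \<alpha>' k" if "lower \<alpha> k" "\<alpha>' \<le> \<alpha>" for \<alpha> \<alpha>' k
    using that mult_right_mono[of \<alpha>' \<alpha> "real k ^ ?n"] unfolding lower_def
    by (meson of_nat_0_le_iff order_trans zero_le_power)
  have upper_mono: "upper \<beta>' k" if "upper \<beta> k" "\<beta> \<le> \<beta>'" for \<beta> \<beta>' k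
    using that mult_right_mono[of \<beta> \<beta>' "real k ^ ?n"] unfolding upper_def
    by (meson of_nat_0_le_iff order_trans zero_le_power)
  define A where "A = {\<alpha>. \<exists>k>0. lower \<alpha> k}"
  define B where "B = {\<beta>. \<exists>k>0. upper \<beta> k}"
  have le: "\<alpha> \<le> \<beta>" if mem: "\<alpha> \<in> A" "\<beta> \<in> B" for \<alpha> \<beta>
  proof -
    obtain j k where jk: "j > 0" "k > 0" "lower \<alpha> j" "upper \<beta> k" 
      using mem unfolding A_def B_def by blast
    \<comment> \<open>Two bounds found at different sides become comparable at a common
      multiple.\<close>
    have "lower \<alpha> (k * j)" "upper \<beta> (k * j)"
      using lower_scale[OF jk(1,3), of k] upper_scale[OF jk(2,4), of j]
      by (simp_all add: mult.commute)
    then have "\<alpha> * real (k * j) ^ ?n \<le> \<beta> * real (k * j) ^ ?n"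
      unfolding lower_def upper_def by (fast intro: order_trans)
    then show ?thesis using jk by (simp add: mult_le_cancel_right)
  qed
  have "lower 0 1" by (simp add: lower_def)
  then have A0: "0 \<in> A" unfolding A_def by (auto intro!: exI[of _ 1])
  obtain D where "\<And>p k. real (card (X \<inter> hcube p (real k))) \<le> D * real k ^ ?n"
    using delone_card_hcube[OF X] by blast
  moreover have "card (Y z \<inter> hcube p s) \<le> card (X \<inter> hcube p s)" for p s
    by (rule card_mono[OF finite_hcube[OF X]]) (auto simp: Y_def)
  ultimately have "upper D 1" unfolding upper_def by (meson of_nat_le_iff order_trans)
  then have BD: "D \<in> B" unfolding B_def by (auto intro!: exI[of _ 1])
  have bdd: "bdd_above A" "bdd_below B"
    by (rule bdd_aboveI[of _ D], rule le[OF _ BD], assumption)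
      (rule bdd_belowI[of _ 0], rule le[OF A0], assumption)
  define l u where lu: "l = Sup A" "u = Inf B"
  have low: "\<exists>k>0. lower (l - \<epsilon>) k" if "\<epsilon> > 0" for \<epsilon>
  proof -
    have "l - \<epsilon> < Sup A" using that by (simp add: lu)
    then obtain \<alpha> where "\<alpha> \<in> A" "l - \<epsilon> < \<alpha>" using less_cSupD[of A] A0 by blast
    then show ?thesis using lower_mono unfolding A_def by (auto intro: less_imp_le)
  qed
  have high: "\<exists>k>0. upper (u + \<epsilon>) k" if "\<epsilon> > 0" for \<epsilon>
  proof -
    have "Inf B < u + \<epsilon>" using that by (simp add: lu)
    then obtain \<beta> where "\<beta> \<in> B" "\<beta> < u + \<epsilon>" using cInf_lessD[of B] BD by blast
    then show ?thesis using upper_mono unfolding B_def by (auto intro: less_imp_le)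
  qed
  have both: "\<exists>k\<ge>k0. k > 0 \<and> lower (l - \<epsilon>) k \<and> upper (u + \<epsilon>) k" if \<epsilon>: "\<epsilon> > 0" for \<epsilon> k0
  proof -
    obtain i j where ij: "i > 0" "j > 0" "lower (l - \<epsilon>) i" "upper (u + \<epsilon>) j"
      using low[OF \<epsilon>] high[OF \<epsilon>] by blast
    \<comment> \<open>The factor \<open>Suc k0\<close> pushes the common multiple of
      \<open>i\<close> and \<open>j\<close> beyond \<open>k0\<close>.\<close>
    have "lower (l - \<epsilon>) (Suc k0 * j * i)" "upper (u + \<epsilon>) (Suc k0 * i * j)"
      using lower_scale[OF ij(1,3)] upper_scale[OF ij(2,4)] by blast+
    moreover have "Suc k0 * j * i = Suc k0 * i * j" by (simp only: mult_ac)
    moreover have "Suc k0 * i * j \<ge> k0"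
      using mult_le_mono[of k0 "Suc k0" 1 "i * j"] ij(1,2)
      by (simp only: mult.assoc) (simp add: Suc_leI)
    moreover have "Suc k0 * i * j > 0" using ij(1,2) by simp
    ultimately show ?thesis by metis
  qed
  have "u \<le> l"
  proof (rule ccontr)
    assume "\<not> u \<le> l"
    then have "l < u" by simp
    then show False
    proof (rule uniform_density_contradiction[OF X rep, where z = z, folded Yz])
      show "\<exists>k\<ge>k0. k > 0 \<and>
        (\<forall>q. (l - \<epsilon>) * real k ^ ?n \<le> real (card (Y z \<inter> hcube q (real k))) \<and>
          real (card (Y z \<inter> hcube q (real k))) \<le> (u + \<epsilon>) * real k ^ ?n)"
        if "\<epsilon> > 0" for \<epsilon> k0
        using both[OF that] unfolding lower_def upper_def by blast
      show "\<exists>p. real (card (Y z \<inter> hcube p (real k))) \<le> (l + \<epsilon>) * real k ^ ?n"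
        if "\<epsilon> > 0" "k > 0" for \<epsilon> and k :: nat
      proof (rule ccontr)
        assume "\<not> ?thesis"
        \<comment> \<open>If no cube of this side had density at most \<open>l + \<epsilon>\<close>,
          then \<open>l + \<epsilon>\<close> would be a uniform lower bound above the supremum
          \<open>l\<close>.\<close>
        then have "lower (l + \<epsilon>) k" unfolding lower_def by (meson linear)
        then have "l + \<epsilon> \<in> A" using that(2) by (auto simp: A_def)
        then have "l + \<epsilon> \<le> l" using cSup_upper[OF _ bdd(1), folded lu(1)] by blast
        then show False using that(1) by simp
      qed
      show "\<exists>p. (u - \<epsilon>) * real k ^ ?n \<le> real (card (Y z \<inter> hcube p (real k)))"
        if "\<epsilon> > 0" "k > 0" for \<epsilon> and k :: nat
      proof (rule ccontr)
        assume "\<not> ?thesis"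
        then have "upper (u - \<epsilon>) k" unfolding upper_def by (meson linear)
        then have "u - \<epsilon> \<in> B" using that(2) by (auto simp: B_def)
        then have "u \<le> u - \<epsilon>" using cInf_lower[OF _ bdd(2), folded lu(2)] by blast
        then show False using that(1) by simp
      qed
    qed
  qed
  show thesis
  proof (rule that[of l])
    fix e :: real assume e: "e > 0"
    then obtain k where k: "k > 0" "lower (l - e) k" "upper (u + e) k" using both by blast
    then have "upper (l + e) k" using upper_mono \<open>u \<le> l\<close> by simp
    then show "\<exists>t>0. \<forall>p. (l - e) * t ^ ?n \<le> real (card (Y z \<inter> hcube p t)) \<and>
        real (card (Y z \<inter> hcube p t)) \<le> (l + e) * t ^ ?n"
      using k(1,2) unfolding lower_def upper_def by (intro exI[of _ "real k"]) auto
  qed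
qed

section \<open>Counting in balls\<close>

lemma measure_hcube:
  fixes p :: "real ^ 'n"
  assumes s: "s > 0"
  shows "hcube p s \<in> fmeasurable lborel" "measure lborel (hcube p s) = s ^ CARD('n)"
proof -
  define q where "q = (\<chi> i. p $ i + s)"
  \<comment> \<open>The half-open cube is squeezed between an open and a closed box of equal
    volume.\<close>
  have sub: "box p q \<subseteq> hcube p s" "hcube p s \<subseteq> cbox p q"
    by (auto simp: hcube_def q_def mem_box_cart less_imp_le)
  have "hcube p s = (\<Inter>i. {y. y $ i \<ge> p $ i} \<inter> {y. y $ i < p $ i + s})"
    by (auto simp: hcube_def)
  also have "\<dots> \<in> sets borel"
    by (intro sets.countable_INT' sets.Int borel_closed borel_open
        closed_halfspace_component_ge_cart open_halfspace_component_lt_cart) auto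
  finally have sets: "hcube p s \<in> sets lborel" by simp
  show fm: "hcube p s \<in> fmeasurable lborel"
    by (rule fmeasurableI2[OF _ sub(2) sets]) (simp add: fmeasurable_cbox)
  have "p \<in> cbox p q" using s by (simp add: mem_box_cart q_def)
  then have "cbox p q \<noteq> {}" by blast
  then have cbox: "measure lborel (cbox p q) = s ^ CARD('n)"
    by (simp add: content_cbox_cart q_def)
  have box: "measure lborel (box p q) = measure lborel (cbox p q)"
    by (simp add: measure_lborel_box_eq measure_lborel_cbox_eq)
  have "measure lborel (box p q) \<le> measure lborel (hcube p s)"
    by (rule measure_mono_fmeasurable[OF sub(1) _ fm]) simp
  moreover have "measure lborel (hcube p s) \<le> measure lborel (cbox p q)"
    by (rule measure_mono_fmeasurable[OF sub(2) sets]) (simp add: fmeasurable_cbox)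
  ultimately show "measure lborel (hcube p s) = s ^ CARD('n)" using box cbox by simp
qed

lemma measure_cells:
  fixes S :: "(int ^ 'n) set"
  assumes t: "t > 0" and S: "finite S"
  shows "{y. cell_index p t y \<in> S} \<in> fmeasurable lborel"
    and "measure lborel {y. cell_index p t y \<in> S} = real (card S) * t ^ CARD('n)"
proof -
  have eq: "{y. cell_index p t y \<in> S} = (\<Union>a\<in>S. {y. cell_index p t y = a})" by auto
  have fm: "{y. cell_index p t y = a} \<in> fmeasurable lborel" for a
    using measure_hcube(1)[OF t] by (simp add: cell_index_vimage t)
  show "{y. cell_index p t y \<in> S} \<in> fmeasurable lborel"
    unfolding eq using S fm by (intro fmeasurable.finite_UN) auto
  have "measure lborel (\<Union>a\<in>S. {y. cell_index p t y = a}) =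
      (\<Sum>a\<in>S. measure lborel {y. cell_index p t y = a})"
    by (rule measure_UNION'[OF S fm]) (auto simp: pairwise_def disjnt_def)
  then show "measure lborel {y. cell_index p t y \<in> S} = real (card S) * t ^ CARD('n)"
    unfolding eq using measure_hcube(2)[OF t, where 'n = 'n] by (simp add: cell_index_vimage t)
qed

lemma measure_ball:
  assumes "r \<ge> 0"
  shows "measure lborel (ball (0 :: real ^ 'n) r) =
    measure lborel (cball (0 :: real ^ 'n) 1) * r ^ CARD('n)"
  using assms by (simp add: content_ball content_cball)

lemma norm_diff_same_cell:
  fixes y :: "real ^ 'n"
  assumes "t > 0" "cell_index p t y = cell_index p t y'"
  shows "norm (y - y') \<le> real CARD('n) * t"
proof -
  have coord: "\<bar>(y - y') $ i\<bar> \<le> t" for i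
  proof -
    have "\<lfloor>(y $ i - p $ i) / t\<rfloor> = \<lfloor>(y' $ i - p $ i) / t\<rfloor>"
      using assms(2) by (simp add: cell_index_def vec_eq_iff)
    then have "\<bar>(y $ i - p $ i) / t - (y' $ i - p $ i) / t\<bar> \<le> 1" by linarith
    then have "\<bar>(y $ i - y' $ i) / t\<bar> \<le> 1" by (simp flip: diff_divide_distrib)
    then show ?thesis using assms(1) by simp
  qed
  have "norm (y - y') \<le> (\<Sum>i\<in>UNIV. \<bar>(y - y') $ i\<bar>)" by (rule norm_le_l1_cart)
  also have "\<dots> \<le> (\<Sum>i\<in>(UNIV :: 'n set). t)" using coord by (rule sum_mono)
  finally show ?thesis by simp
qed

lemma finite_cells_ball:
  fixes p :: "real ^ 'n"
  assumes "t > 0"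
  shows "finite (cell_index p t ` ball 0 T)"
proof -
  define m where "m = \<lceil>(T + norm p) / t\<rceil> + 1"
  have "cell_index p t ` ball 0 T \<subseteq> grid (- m) m"
  proof (intro image_subsetI)
    fix y :: "real ^ 'n" assume y: "y \<in> ball 0 T"
    have "- m \<le> \<lfloor>(y $ i - p $ i) / t\<rfloor> \<and> \<lfloor>(y $ i - p $ i) / t\<rfloor> < m" for i
    proof -
      have "\<bar>y $ i - p $ i\<bar> \<le> T + norm p"
        using component_le_norm_cart[of "y - p" i] norm_triangle_ineq4[of y p] y by simp
      then have "\<bar>(y $ i - p $ i) / t\<bar> \<le> (T + norm p) / t"
        using assms by (simp add: divide_right_mono)
      then show ?thesis unfolding m_def by linarith
    qed
    then show "cell_index p t y \<in> grid (- m) m"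
      by (simp add: grid_def cell_index_def)
  qed
  then show ?thesis using finite_subset finite_grid by blast
qed

text \<open>The union \<open>U\<close> of the cells meeting the ball of radius \<open>T\<close>
  contains this ball and lies in the one with radius enlarged by \<open>n * t\<close>. Its volume is
  the number of cells times \<open>t ^ n\<close>, so bounds per cell become bounds by the volume of
  a ball.\<close>

lemma card_ball_bounds:
  fixes Y :: "(real ^ 'n) set"
  assumes t: "t > 0" and fin: "\<And>p s. finite (Y \<inter> hcube p s)" and T: "T \<ge> 0"
  defines "\<kappa> \<equiv> measure lborel (cball (0 :: real ^ 'n) 1)"
  shows "(\<And>p. real (card (Y \<inter> hcube p t)) \<le> \<beta> * t ^ CARD('n)) \<Longrightarrow>
      real (card (Y \<inter> ball 0 T)) \<le> \<beta> * \<kappa> * (T + real CARD('n) * t) ^ CARD('n)"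
    and "(\<And>p. \<alpha> * t ^ CARD('n) \<le> real (card (Y \<inter> hcube p t))) \<Longrightarrow>
      \<alpha> * \<kappa> * T ^ CARD('n) \<le> real (card (Y \<inter> ball 0 (T + real CARD('n) * t)))"
proof -
  let ?n = "CARD('n)"
  define I where "I = cell_index (0 :: real ^ 'n) t ` ball 0 T"
  define U where "U = {y :: real ^ 'n. cell_index 0 t y \<in> I}"
  have I: "finite I" unfolding I_def by (rule finite_cells_ball[OF t])
  have U: "U \<in> fmeasurable lborel" "measure lborel U = real (card I) * t ^ ?n"
    unfolding U_def using measure_cells[OF t I] by blast+
  have inner: "ball 0 T \<subseteq> U" by (auto simp: U_def I_def)
  have outer: "U \<subseteq> ball 0 (T + real ?n * t)"
  proof
    fix y assume "y \<in> U"
    then obtain y' where y': "y' \<in> ball 0 T" "cell_index 0 t y = cell_index 0 t y'"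
      by (auto simp: U_def I_def)
    have "norm y \<le> norm y' + norm (y - y')" using norm_triangle_sub by blast
    then show "y \<in> ball 0 (T + real ?n * t)" using y'(1) norm_diff_same_cell[OF t y'(2)] by simp
  qed
  have cells: "finite (Y \<inter> {y. cell_index 0 t y = a})" for a
    using fin by (simp add: cell_index_vimage t)
  have cardU: "card (Y \<inter> U) = (\<Sum>a\<in>I. card (Y \<inter> {y. cell_index 0 t y = a}))"
    unfolding U_def using card_cells[OF I] cells by blast
  have finball: "finite (Y \<inter> ball 0 R)" for R
  proof -
    have "finite (\<Union>a\<in>cell_index 0 t ` ball 0 R. Y \<inter> {y. cell_index 0 t y = a})"
      using finite_cells_ball[OF t] cells by blast
    then show ?thesis by (rule rev_finite_subset) auto
  qed
  have finU: "finite (Y \<inter> U)" using finball outer by (meson Int_mono finite_subset order_refl)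
  show "real (card (Y \<inter> ball 0 T)) \<le> \<beta> * \<kappa> * (T + real ?n * t) ^ ?n"
    if \<beta>: "\<And>p. real (card (Y \<inter> hcube p t)) \<le> \<beta> * t ^ ?n"
  proof -
    \<comment> \<open>A count is nonnegative, hence so is \<open>\<beta>\<close>, and replacing the
      volume of \<open>U\<close> by that of the larger ball preserves the upper bound.\<close>
    have "0 \<le> \<beta> * t ^ ?n" using \<beta>[of 0] by (rule order_trans[OF of_nat_0_le_iff])
    then have "\<beta> \<ge> 0" using t zero_less_power[OF t, of ?n] by (simp add: zero_le_mult_iff)
    have "card (Y \<inter> ball 0 T) \<le> card (Y \<inter> U)" using inner finU by (intro card_mono) auto
    then have "real (card (Y \<inter> ball 0 T)) \<le> (\<Sum>a\<in>I. real (card (Y \<inter> {y. cell_index 0 t y = a})))"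
      by (simp add: cardU flip: of_nat_sum)
    also have "\<dots> \<le> (\<Sum>a\<in>I. \<beta> * t ^ ?n)"
      by (rule sum_mono) (use \<beta> in \<open>simp add: cell_index_vimage t\<close>)
    also have "\<dots> = \<beta> * measure lborel U" by (simp add: U)
    also have "\<dots> \<le> \<beta> * measure lborel (ball (0 :: real ^ 'n) (T + real ?n * t))"
      using \<open>\<beta> \<ge> 0\<close> outer U(1) emeasure_lborel_ball_finite[of "0 :: real ^ 'n" "T + real ?n * t"]
      by (intro mult_left_mono measure_mono_fmeasurable) (auto simp: fmeasurable_def)
    also have "\<dots> = \<beta> * \<kappa> * (T + real ?n * t) ^ ?n"
      using T t by (simp add: measure_ball \<kappa>_def)
    finally show ?thesis .
  qed
  show "\<alpha> * \<kappa> * T ^ ?n \<le> real (card (Y \<inter> ball 0 (T + real ?n * t)))"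
    if \<alpha>: "\<And>p. \<alpha> * t ^ ?n \<le> real (card (Y \<inter> hcube p t))"
  proof (cases "\<alpha> \<ge> 0")
    case True
    have "\<alpha> * \<kappa> * T ^ ?n = \<alpha> * measure lborel (ball (0 :: real ^ 'n) T)"
      using T by (simp add: measure_ball \<kappa>_def)
    also have "\<dots> \<le> \<alpha> * measure lborel U"
      using True inner U(1) by (intro mult_left_mono measure_mono_fmeasurable) auto
    also have "\<dots> = (\<Sum>a\<in>I. \<alpha> * t ^ ?n)" by (simp add: U)
    also have "\<dots> \<le> (\<Sum>a\<in>I. real (card (Y \<inter> {y. cell_index 0 t y = a})))"
      by (rule sum_mono) (use \<alpha> in \<open>simp add: cell_index_vimage t\<close>)
    also have "\<dots> = real (card (Y \<inter> U))" by (simp add: cardU)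
    also have "\<dots> \<le> real (card (Y \<inter> ball 0 (T + real ?n * t)))"
      using outer finball by (intro of_nat_mono card_mono) auto
    finally show ?thesis .
  next
    case False
    then have "\<alpha> * (\<kappa> * T ^ ?n) \<le> 0" using T by (intro mult_nonpos_nonneg) (auto simp: \<kappa>_def)
    then show ?thesis by (simp add: mult.assoc)
  qed
qed

text \<open>The weight of the point mass at \<open>z\<close> before normalisation: a pair with
  difference \<open>z\<close> is recorded by its second point \<open>y\<close>, the first being
  \<open>y + z\<close>.\<close>

definition pair_count :: "(real ^ 'n) set \<Rightarrow> real ^ 'n \<Rightarrow> real \<Rightarrow> nat" where
  "pair_count X z T = card {y \<in> X. norm y < T \<and> y + z \<in> X \<and> norm (y + z) < T}"

text \<open>The requirement on \<open>y + z\<close> affects only a shell of width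
  \<open>norm z\<close>, so the pairs are squeezed between the counts of \<open>Y\<close> in two
  balls. All shells have bounded width and vanish relative to the volume as \<open>T\<close>
  grows.\<close>

lemma pair_frequency_converges:
  fixes X :: "(real ^ 'n) set"
  assumes X: "delone X" and rep: "linearly_repetitive X \<or> densely_repetitive X"
  shows "\<exists>d. ((\<lambda>T. real (pair_count X z T) /
    (measure lborel (cball (0 :: real ^ 'n) 1) * T ^ CARD('n))) \<longlongrightarrow> d) at_top"
proof -
  let ?n = "CARD('n)"
  define \<kappa> where "\<kappa> = measure lborel (cball (0 :: real ^ 'n) 1)"
  define Y where "Y = {x \<in> X. x + z \<in> X}"
  have \<kappa>: "\<kappa> > 0" by (simp add: \<kappa>_def)
  have fin: "finite (Y \<inter> hcube p s)" for p s
    by (rule finite_subset[OF _ finite_hcube[OF X, of p s]]) (auto simp: Y_def)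
  have finball: "finite (Y \<inter> ball 0 T)" for T
    by (rule finite_subset[OF _ delone_finite_cball[OF X, of 0 T]]) (auto simp: Y_def)
  have upper: "pair_count X z T \<le> card (Y \<inter> ball 0 T)" for T
    unfolding pair_count_def using finball by (intro card_mono) (auto simp: Y_def)
  have lower: "card (Y \<inter> ball 0 (T - norm z)) \<le> pair_count X z T" for T
    unfolding pair_count_def
  proof (intro card_mono)
    show "finite {y \<in> X. norm y < T \<and> y + z \<in> X \<and> norm (y + z) < T}"
      by (rule finite_subset[OF _ finball[of T]]) (auto simp: Y_def)
    have "norm (y + z) < T" "norm y < T" if "norm y < T - norm z" for y
      using that norm_triangle_ineq[of y z] norm_ge_zero[of z] by linarith+
    then show "Y \<inter> ball 0 (T - norm z) \<subseteq> {y \<in> X. norm y < T \<and> y + z \<in> X \<and> norm (y + z) < T}"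
      by (auto simp: Y_def)
  qed
  obtain d where d: "\<And>e. e > 0 \<Longrightarrow> \<exists>t>0. \<forall>p. (d - e) * t ^ ?n \<le> real (card (Y \<inter> hcube p t)) \<and>
      real (card (Y \<inter> hcube p t)) \<le> (d + e) * t ^ ?n"
    using uniform_density[OF X rep, where z = z] unfolding Y_def by blast
  let ?F = "\<lambda>T. real (pair_count X z T) / (\<kappa> * T ^ ?n)"
  have "(?F \<longlongrightarrow> d) at_top"
  proof (rule order_tendstoI)
    fix a assume "a < d"
    define e where "e = (d - a) / 2"
    have e: "e > 0" "d - e > a" using \<open>a < d\<close> by (auto simp: e_def field_simps)
    obtain t where t: "t > 0" "\<And>p. (d - e) * t ^ ?n \<le> real (card (Y \<inter> hcube p t))"
      using d[OF e(1)] by blast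
    \<comment> \<open>The total loss of radius: \<open>norm z\<close> from the squeeze and
      \<open>n * t\<close> from approximating the ball by cells.\<close>
    define b where "b = norm z + real ?n * t"
    have "((\<lambda>T. (d - e) * (1 - b / T) ^ ?n) \<longlongrightarrow> (d - e) * (1 - 0) ^ ?n) at_top"
      by (intro tendsto_intros tendsto_divide_0[OF tendsto_const]
          filterlim_at_top_imp_at_infinity filterlim_ident)
    then have "eventually (\<lambda>T. a < (d - e) * (1 - b / T) ^ ?n) at_top"
      using order_tendstoD(1) e(2) by fastforce
    moreover have "eventually (\<lambda>T. T > max b 0) at_top" by (rule eventually_gt_at_top)
    ultimately show "eventually (\<lambda>T. a < ?F T) at_top"
    proof eventually_elim
      case (elim T)
      have "(d - e) * \<kappa> * (T - b) ^ ?n \<le> real (card (Y \<inter> ball 0 (T - b + real ?n * t)))"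
        unfolding \<kappa>_def using elim by (intro card_ball_bounds(2)[OF t(1) fin _ t(2)]) simp
      also have "T - b + real ?n * t = T - norm z" by (simp add: b_def)
      also have "real (card (Y \<inter> ball 0 (T - norm z))) \<le> real (pair_count X z T)"
        using lower by simp
      finally have "(d - e) * \<kappa> * (T - b) ^ ?n / (\<kappa> * T ^ ?n) \<le> ?F T"
        using \<kappa> elim by (intro divide_right_mono) auto
      moreover have "(d - e) * \<kappa> * (T - b) ^ ?n / (\<kappa> * T ^ ?n) = (d - e) * (T - b) ^ ?n / T ^ ?n"
        using \<kappa> by simp
      moreover have "1 - b / T = (T - b) / T" using elim by (simp add: field_simps)
      ultimately show ?case using elim(1) by (simp add: power_divide)
    qed
  next
    fix a assume "d < a"
    define e where "e = (a - d) / 2"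
    have e: "e > 0" "d + e < a" using \<open>d < a\<close> by (auto simp: e_def field_simps)
    obtain t where t: "t > 0" "\<And>p. real (card (Y \<inter> hcube p t)) \<le> (d + e) * t ^ ?n"
      using d[OF e(1)] by blast
    define b where "b = real ?n * t"
    have "((\<lambda>T. (d + e) * (1 + b / T) ^ ?n) \<longlongrightarrow> (d + e) * (1 + 0) ^ ?n) at_top"
      by (intro tendsto_intros tendsto_divide_0[OF tendsto_const]
          filterlim_at_top_imp_at_infinity filterlim_ident)
    then have "eventually (\<lambda>T. (d + e) * (1 + b / T) ^ ?n < a) at_top"
      using order_tendstoD(2) e(2) by fastforce
    moreover have "eventually (\<lambda>T. T > (0 :: real)) at_top" by (rule eventually_gt_at_top)
    ultimately show "eventually (\<lambda>T. ?F T < a) at_top"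
    proof eventually_elim
      case (elim T)
      have "real (pair_count X z T) \<le> real (card (Y \<inter> ball 0 T))" using upper by simp
      also have "\<dots> \<le> (d + e) * \<kappa> * (T + b) ^ ?n"
        unfolding \<kappa>_def b_def using elim by (intro card_ball_bounds(1)[OF t(1) fin _ t(2)]) simp
      finally have "?F T \<le> (d + e) * \<kappa> * (T + b) ^ ?n / (\<kappa> * T ^ ?n)"
        using \<kappa> elim by (intro divide_right_mono) auto
      moreover have "(d + e) * \<kappa> * (T + b) ^ ?n / (\<kappa> * T ^ ?n) = (d + e) * (T + b) ^ ?n / T ^ ?n"
        using \<kappa> by simp
      moreover have "1 + b / T = (T + b) / T" using elim by (simp add: field_simps)
      ultimately show ?case using elim(1) by (simp add: power_divide)
    qed
  qed
  then show ?thesis unfolding \<kappa>_def by blast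
qed

section \<open>Discrete functionals and the autocorrelation\<close>

lemma test_function_support:
  assumes "f \<in> test_functions"
  obtains R where "\<forall>z. f z \<noteq> 0 \<longrightarrow> norm z \<le> R"
proof -
  have "compact (closure {x. f x \<noteq> 0})"
    using assms unfolding test_functions_def by blast
  from compact_imp_bounded[OF this] obtain R where R: "\<forall>z\<in>closure {x. f x \<noteq> 0}. norm z \<le> R"
    unfolding bounded_iff by blast
  have "norm z \<le> R" if "f z \<noteq> 0" for z
    using R closure_subset[of "{x. f x \<noteq> 0}"] that by blast
  then show thesis using that by blast
qed

lemma test_function_le_SUP:
  assumes "f \<in> test_functions"
  shows "norm (f z) \<le> (SUP x. norm (f x))"
proof (rule cSUP_upper)
  let ?K = "closure {x. f x \<noteq> 0}"
  have "continuous_on ?K f" "compact ?K"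
    using assms continuous_on_subset[OF _ subset_UNIV] unfolding test_functions_def by blast+
  then have "compact (f ` ?K)" by (rule compact_continuous_image)
  from compact_imp_bounded[OF this] obtain B where B: "\<forall>y\<in>f ` ?K. norm y \<le> B"
    unfolding bounded_iff by blast
  \<comment> \<open>Off the support the value is 0, which the bound on the support need not dominate
    when the support is empty; hence the maximum with 0.\<close>
  have le: "norm (f x) \<le> max B 0" for x
  proof (cases "f x = 0")
    case False
    then have "x \<in> ?K" by (intro subsetD[OF closure_subset] CollectI)
    then have "norm (f x) \<le> B" using B by blast
    then show ?thesis by simp
  qed simp
  show "bdd_above (range (\<lambda>x. norm (f x)))" by (rule bdd_aboveI2[OF le])
qed simp

text \<open>The measure with mass \<open>c z\<close> at each \<open>z\<close> in \<open>A\<close>,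
  restricted so as to be extensional, as measures are here.\<close>

definition discrete_functional ::
  "(real ^ 'n) set \<Rightarrow> (real ^ 'n \<Rightarrow> complex) \<Rightarrow> (real ^ 'n \<Rightarrow> complex) \<Rightarrow> complex" where
  "discrete_functional A c = (\<lambda>f\<in>test_functions. \<Sum>\<^sub>\<infinity>z\<in>A. c z * f z)"

lemma discrete_functional_eq:
  assumes "f \<in> test_functions" "finite (A \<inter> cball 0 R)" "\<forall>z. f z \<noteq> 0 \<longrightarrow> norm z \<le> R"
  shows "discrete_functional A c f = (\<Sum>z\<in>A \<inter> cball 0 R. c z * f z)"
proof -
  have "(\<Sum>\<^sub>\<infinity>z\<in>A. c z * f z) = (\<Sum>\<^sub>\<infinity>z\<in>A \<inter> cball 0 R. c z * f z)"
    using assms(3) by (intro infsum_cong_neutral) auto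
  then show ?thesis using assms(1,2) by (simp add: discrete_functional_def)
qed

lemma test_functions_add:
  assumes "f \<in> test_functions" "g \<in> test_functions"
  shows "(\<lambda>x. f x + g x) \<in> test_functions"
proof -
  have "{x. f x + g x \<noteq> 0} \<subseteq> {x. f x \<noteq> 0} \<union> {x. g x \<noteq> 0}" by auto
  also have "\<dots> \<subseteq> closure {x. f x \<noteq> 0} \<union> closure {x. g x \<noteq> 0}"
    by (intro Un_mono closure_subset)
  finally have "{x. f x + g x \<noteq> 0} \<subseteq> closure {x. f x \<noteq> 0} \<union> closure {x. g x \<noteq> 0}" .
  moreover have "compact (closure {x. f x \<noteq> 0} \<union> closure {x. g x \<noteq> 0})"
    using assms unfolding test_functions_def by (blast intro: compact_Un)
  ultimately have "compact (closure {x. f x + g x \<noteq> 0})"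
    by (meson bounded_subset compact_closure compact_imp_bounded)
  then show ?thesis
    using assms by (auto simp: test_functions_def intro: continuous_on_add)
qed

lemma test_functions_mult:
  assumes "f \<in> test_functions"
  shows "(\<lambda>x. a * f x) \<in> test_functions"
proof -
  have "{x. a * f x \<noteq> 0} \<subseteq> closure {x. f x \<noteq> 0}"
    using closure_subset[of "{x. f x \<noteq> 0}"] by auto
  moreover have "compact (closure {x. f x \<noteq> 0})"
    using assms unfolding test_functions_def by blast
  ultimately have "compact (closure {x. a * f x \<noteq> 0})"
    by (meson bounded_subset compact_closure compact_imp_bounded)
  then show ?thesis
    using assms by (auto simp: test_functions_def intro: continuous_on_mult continuous_on_const)
qed

lemma functional_measure_discrete:
  assumes fin: "\<And>R. finite (A \<inter> cball 0 R)"
  shows "functional_measure (discrete_functional A c)"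
  unfolding functional_measure_def
proof (intro conjI allI ballI impI)
  show "discrete_functional A c \<in> extensional test_functions"
    by (simp add: discrete_functional_def)
next
  fix f g :: "real ^ 'a \<Rightarrow> complex"
  assume fg: "f \<in> test_functions" "g \<in> test_functions"
  obtain R1 R2 where R: "\<forall>z. f z \<noteq> 0 \<longrightarrow> norm z \<le> R1" "\<forall>z. g z \<noteq> 0 \<longrightarrow> norm z \<le> R2"
    using test_function_support fg by metis
  define R where "R = max R1 R2"
  have R_f: "\<forall>z. f z \<noteq> 0 \<longrightarrow> norm z \<le> R" and R_g: "\<forall>z. g z \<noteq> 0 \<longrightarrow> norm z \<le> R"
    using R by (auto simp: R_def le_max_iff_disj)
  have R_fg: "\<forall>z. f z + g z \<noteq> 0 \<longrightarrow> norm z \<le> R"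
    using R_f R_g by (metis add.right_neutral)
  show "discrete_functional A c (\<lambda>x. f x + g x) = discrete_functional A c f + discrete_functional A c g"
    unfolding discrete_functional_eq[OF fg(1) fin R_f] discrete_functional_eq[OF fg(2) fin R_g]
      discrete_functional_eq[OF test_functions_add[OF fg] fin R_fg]
    by (simp add: distrib_left sum.distrib)
next
  fix a and f :: "real ^ 'a \<Rightarrow> complex"
  assume f: "f \<in> test_functions"
  obtain R where R: "\<forall>z. f z \<noteq> 0 \<longrightarrow> norm z \<le> R" using test_function_support f by metis
  have aR: "\<forall>z. a * f z \<noteq> 0 \<longrightarrow> norm z \<le> R" using R by auto
  show "discrete_functional A c (\<lambda>x. a * f x) = a * discrete_functional A c f"
    unfolding discrete_functional_eq[OF f fin R] discrete_functional_eq[OF test_functions_mult[OF f] fin aR]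
    by (simp add: sum_distrib_left mult_ac)
next
  fix K :: "(real ^ 'a) set" assume "compact K"
  from compact_imp_bounded[OF this] obtain R where R: "\<forall>z\<in>K. norm z \<le> R"
    unfolding bounded_iff by blast
  \<comment> \<open>The total mass of the finitely many atoms in a ball containing \<open>K\<close>
    serves as the constant for \<open>K\<close>.\<close>
  have "norm (discrete_functional A c f) \<le> (\<Sum>z\<in>A \<inter> cball 0 R. norm (c z)) * (SUP x. norm (f x))"
    if f: "f \<in> test_functions" "closure {x. f x \<noteq> 0} \<subseteq> K" for f
  proof -
    have "\<forall>z. f z \<noteq> 0 \<longrightarrow> norm z \<le> R"
      using f(2) R closure_subset[of "{x. f x \<noteq> 0}"] by blast
    then have "discrete_functional A c f = (\<Sum>z\<in>A \<inter> cball 0 R. c z * f z)"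
      by (rule discrete_functional_eq[OF f(1) fin])
    then have "norm (discrete_functional A c f) = norm (\<Sum>z\<in>A \<inter> cball 0 R. c z * f z)"
      by simp
    also have "\<dots> \<le> (\<Sum>z\<in>A \<inter> cball 0 R. norm (c z) * (SUP x. norm (f x)))"
      using test_function_le_SUP[OF f(1)]
      by (intro sum_norm_le) (simp add: norm_mult mult_left_mono)
    finally show ?thesis by (simp add: sum_distrib_right)
  qed
  then show "\<exists>C. \<forall>f\<in>test_functions. closure {x. f x \<noteq> 0} \<subseteq> K \<longrightarrow>
      norm (discrete_functional A c f) \<le> C * (SUP x. norm (f x))"
    by blast
qed

lemma pure_discrete_on_discrete_functional:
  assumes "\<And>R. finite (A \<inter> cball 0 R)"
  shows "pure_discrete_on A (discrete_functional A c)"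
proof -
  have "finite (A \<inter> K)" if K: "compact K" for K
  proof -
    obtain R where "\<forall>x\<in>K. norm x \<le> R"
      using compact_imp_bounded[OF K] unfolding bounded_iff by blast
    then have "K \<subseteq> cball 0 R" by auto
    then show ?thesis using assms[of R] by (meson Int_mono finite_subset order_refl)
  qed
  then show ?thesis
    unfolding pure_discrete_on_def by (intro exI[of _ c]) (auto simp: discrete_functional_def)
qed

section \<open>Differences of points and the limit of the autocorrelation\<close>

lemma finite_differences:
  fixes X :: "(real ^ 'n) set"
  assumes "delone X" "repetitive X"
  shows "finite ({x - y | x y. x \<in> X \<and> y \<in> X} \<inter> cball 0 R)"
proof -
  \<comment> \<open>Radius at least 1 makes \<open>T\<close> positive, as finiteness of the set of
    patches requires. A difference of norm at most \<open>T\<close> is an element of the patch at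
    its second point, and there are finitely many patches, each finite.\<close>
  define T where "T = max R 1"
  have "finite (\<Union>(centred_patch X T ` X))"
  proof (rule finite_Union)
    show "finite (centred_patch X T ` X)" using finite_patches[OF assms, of T] by (simp add: T_def)
    show "finite P" if "P \<in> centred_patch X T ` X" for P
      using that delone_finite_cball[OF assms(1)] by (auto simp: centred_patch_def)
  qed
  then show ?thesis
  proof (rule rev_finite_subset, intro subsetI)
    fix v assume "v \<in> {x - y | x y. x \<in> X \<and> y \<in> X} \<inter> cball 0 R"
    then obtain x y where "v = x - y" "x \<in> X" "y \<in> X" "norm v \<le> T" by (auto simp: T_def)
    then have "v \<in> centred_patch X T y" by (simp add: mem_centred_patch)
    then show "v \<in> \<Union>(centred_patch X T ` X)" using \<open>y \<in> X\<close> by blast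
  qed
qed

text \<open>Pairs are grouped by their difference. Differences outside \<open>Z\<close> contribute
  nothing, since \<open>f\<close> vanishes there.\<close>

lemma autocorrelation_approx_eq:
  fixes X :: "(real ^ 'n) set"
  assumes X: "delone X" and f: "f \<in> test_functions" and Z: "finite Z"
    and supp: "\<And>x y. x \<in> X \<Longrightarrow> y \<in> X \<Longrightarrow> f (x - y) \<noteq> 0 \<Longrightarrow> x - y \<in> Z"
  shows "autocorrelation_approx X T f = (\<Sum>z\<in>Z. complex_of_real (real (pair_count X z T) /
    (measure lborel (cball (0 :: real ^ 'n) 1) * T ^ CARD('n))) * f z)"
proof -
  define A where "A = {x \<in> X. norm x < T}"
  have A: "finite A"
    by (rule finite_subset[OF _ delone_finite_cball[OF X, of 0 T]]) (auto simp: A_def)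
  have cnt: "card {p \<in> A \<times> A. fst p - snd p = z} = pair_count X z T" for z
    unfolding pair_count_def
    by (rule bij_betw_same_card[of snd], rule bij_betw_byWitness[where f' = "\<lambda>y. (y + z, y)"])
      (auto simp: A_def algebra_simps)
  \<comment> \<open>Each term is spread over \<open>Z\<close> by an indicator, so that exchanging
    the sums counts the pairs with a given difference.\<close>
  have "(\<Sum>(x, y)\<in>A \<times> A. f (x - y)) = (\<Sum>p\<in>A \<times> A. \<Sum>z\<in>Z. if fst p - snd p = z then f z else 0)"
  proof (rule sum.cong[OF refl])
    fix p assume "p \<in> A \<times> A"
    then have "fst p - snd p \<in> Z \<or> f (fst p - snd p) = 0" using supp by (auto simp: A_def)
    then show "(case p of (x, y) \<Rightarrow> f (x - y)) = (\<Sum>z\<in>Z. if fst p - snd p = z then f z else 0)"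
      using Z by (auto simp: case_prod_unfold)
  qed
  also have "\<dots> = (\<Sum>z\<in>Z. \<Sum>p\<in>A \<times> A. if fst p - snd p = z then f z else 0)"
    by (rule sum.swap)
  also have "\<dots> = (\<Sum>z\<in>Z. of_nat (pair_count X z T) * f z)"
    using A by (intro sum.cong) (simp_all add: sum.If_cases cnt Int_def flip: cnt)
  finally have sum: "(\<Sum>(x, y)\<in>A \<times> A. f (x - y)) = (\<Sum>z\<in>Z. of_nat (pair_count X z T) * f z)" .
  have "autocorrelation_approx X T f =
      complex_of_real (1 / (measure lborel (cball (0 :: real ^ 'n) 1) * T ^ CARD('n))) *
      (\<Sum>(x, y)\<in>A \<times> A. f (x - y))"
    using f by (simp add: autocorrelation_approx_def A_def)
  then show ?thesis by (simp add: sum sum_distrib_left)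
qed

text \<open>Only finitely many differences lie in the support of a test function, and the frequency
  of each converges. The limit is taken along real \<open>T\<close>, so every sequence of radii
  tending to infinity inherits it.\<close>

lemma autocorrelation_converges:
  fixes X :: "(real ^ 'n) set"
  assumes X: "delone X" and rep: "linearly_repetitive X \<or> densely_repetitive X"
  obtains c where "\<And>f. f \<in> test_functions \<Longrightarrow>
    ((\<lambda>T. autocorrelation_approx X T f) \<longlongrightarrow>
      discrete_functional {x - y | x y. x \<in> X \<and> y \<in> X} c f) at_top"
proof -
  have repetitive: "repetitive X"
    using rep by (auto simp: linearly_repetitive_def densely_repetitive_def)
  define A where "A = {x - y | x y. x \<in> X \<and> y \<in> X}"
  have fin: "finite (A \<inter> cball 0 R)" for R
    unfolding A_def by (rule finite_differences[OF X repetitive])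
  let ?F = "\<lambda>z T. real (pair_count X z T) / (measure lborel (cball (0 :: real ^ 'n) 1) * T ^ CARD('n))"
  obtain d where d: "\<And>z. (?F z \<longlongrightarrow> d z) at_top"
    using pair_frequency_converges[OF X rep] by metis
  show thesis
  proof (rule that[of "\<lambda>z. complex_of_real (d z)"])
    fix f :: "real ^ 'n \<Rightarrow> complex" assume f: "f \<in> test_functions"
    obtain R where R: "\<forall>z. f z \<noteq> 0 \<longrightarrow> norm z \<le> R" using test_function_support f by metis
    have approx: "autocorrelation_approx X T f =
        (\<Sum>z\<in>A \<inter> cball 0 R. complex_of_real (?F z T) * f z)" for T
      using R by (intro autocorrelation_approx_eq[OF X f fin]) (auto simp: A_def)
    have "((\<lambda>T. \<Sum>z\<in>A \<inter> cball 0 R. complex_of_real (?F z T) * f z) \<longlongrightarrow>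
        (\<Sum>z\<in>A \<inter> cball 0 R. complex_of_real (d z) * f z)) at_top"
      by (intro tendsto_sum tendsto_mult tendsto_of_real d tendsto_const)
    then have "((\<lambda>T. autocorrelation_approx X T f) \<longlongrightarrow>
        discrete_functional A (\<lambda>z. complex_of_real (d z)) f) at_top"
      unfolding approx discrete_functional_eq[OF f fin R] .
    then show "((\<lambda>T. autocorrelation_approx X T f) \<longlongrightarrow>
        discrete_functional {x - y | x y. x \<in> X \<and> y \<in> X} (\<lambda>z. complex_of_real (d z)) f) at_top"
      by (simp only: A_def)
  qed
qed

theorem corollary6p1:
  fixes X :: "(real ^ 'n) set"
  assumes "delone X"
    and "linearly_repetitive X \<or> densely_repetitive X"
  shows "(\<exists>!\<gamma>. autocorrelation_measure X \<gamma>) \<and>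
    (\<forall>\<gamma>. autocorrelation_measure X \<gamma> \<longrightarrow> pure_discrete_on {x - y | x y. x \<in> X \<and> y \<in> X} \<gamma>) \<and>
    diffractive X"
proof -
  define A where "A = {x - y | x y. x \<in> X \<and> y \<in> X}"
  have "repetitive X"
    using assms(2) by (auto simp: linearly_repetitive_def densely_repetitive_def)
  then have fin: "finite (A \<inter> cball 0 R)" for R
    unfolding A_def by (rule finite_differences[OF assms(1)])
  obtain c where c: "\<And>f. f \<in> test_functions \<Longrightarrow>
      ((\<lambda>T. autocorrelation_approx X T f) \<longlongrightarrow> discrete_functional A c f) at_top"
    using autocorrelation_converges[OF assms] unfolding A_def by blast
  let ?\<gamma> = "discrete_functional A c"
  \<comment> \<open>The shift by 1 keeps all radii positive, including the one for
    \<open>k = 0\<close>.\<close>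
  have "vague_limit (\<lambda>k. autocorrelation_approx X (real k + 1)) ?\<gamma>"
    unfolding vague_limit_def
  proof
    fix f :: "real ^ 'n \<Rightarrow> complex" assume "f \<in> test_functions"
    then show "(\<lambda>k. autocorrelation_approx X (real k + 1) f) \<longlonglongrightarrow> ?\<gamma> f"
      by (rule filterlim_compose[OF c])
        (rule filterlim_at_top_mono[OF filterlim_real_sequentially], simp)
  qed
  moreover have "filterlim (\<lambda>k. real k + 1) at_top sequentially"
    by (rule filterlim_at_top_mono[OF filterlim_real_sequentially]) simp
  ultimately have ex: "autocorrelation_measure X ?\<gamma>"
    unfolding autocorrelation_measure_def using functional_measure_discrete[OF fin]
    by (intro conjI exI[of _ "\<lambda>k. real k + 1"]) auto
  \<comment> \<open>The radii producing another autocorrelation measure also tend to infinity, so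
    the two functionals agree on test functions; extensionality settles their values
    elsewhere.\<close>
  have uniq: "\<gamma> = ?\<gamma>" if \<gamma>: "autocorrelation_measure X \<gamma>" for \<gamma>
  proof -
    obtain T where T: "filterlim T at_top sequentially" "vague_limit (\<lambda>k. autocorrelation_approx X (T k)) \<gamma>"
      using \<gamma> unfolding autocorrelation_measure_def by blast
    have "\<gamma> f = ?\<gamma> f" if f: "f \<in> test_functions" for f
    proof (rule LIMSEQ_unique)
      show "(\<lambda>k. autocorrelation_approx X (T k) f) \<longlonglongrightarrow> \<gamma> f"
        using T(2) f by (auto simp: vague_limit_def)
      show "(\<lambda>k. autocorrelation_approx X (T k) f) \<longlonglongrightarrow> ?\<gamma> f"
        by (rule filterlim_compose[OF c[OF f] T(1)])
    qed
    moreover have "\<gamma> \<in> extensional test_functions"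
      using \<gamma> by (simp add: autocorrelation_measure_def functional_measure_def)
    moreover have "?\<gamma> \<in> extensional test_functions" by (simp add: discrete_functional_def)
    ultimately show ?thesis using extensionalityI by blast
  qed
  have "\<exists>!\<gamma>. autocorrelation_measure X \<gamma>" using ex uniq by blast
  moreover have "pure_discrete_on A \<gamma>" if "autocorrelation_measure X \<gamma>" for \<gamma>
    using uniq[OF that] pure_discrete_on_discrete_functional[OF fin] by simp
  ultimately show ?thesis unfolding diffractive_def A_def by blast
qed

end
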